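(* Let $q\ge 6$ be a prime power. Let $\bar{\mathcal C}$ be an $\mathbb F_q$-conic in an $\mathbb F_q$-subplane $\bar\pi$ of $\mathrm{PG}(2,q^3)$ that is secant to $\ell_\infty$, and suppose $\bar{\mathcal C}^+$ meets $\ell_\infty$ in the two points $\{\bar P,\bar Q\}$ (possibly repeated, possibly in an extension). In the exact-at-infinity Bruck-Bose representation in $\mathrm{PG}(6,q)$, $\mathcal V([\mathcal C])$ decomposes into a non-degenerate conic $\mathcal N_2$ (which lies in a plane of $\mathrm{PG}(6,q)$, not contained in $\Sigma_\infty$, that meets $q+1$ spread planes), together with two planes at infinity. Further: 1. If $\bar{\mathcal C}\cap\ell_\infty=\{\bar P,\bar Q\}$, possibly $\bar P=\bar Q$, then $\mathcal V([\mathcal C])$ contains the two spread planes $[P],[Q]$. Moreover, $\mathcal N_2\cap\Sigma_\infty$ is two real points (that is, points over $\mathbb F_q$, coinciding if $\bar P=\bar Q$), one in $[P]$ and one in $[Q]$. 2. If $\bar{\mathcal C}\cap\ell_\infty=\emptyset$, then $\bar{\mathcal C}^+\cap\ell_\infty=\emptyset$ and $\bar{\mathcal C}^{++}\cap\ell_\infty^{++}=\{\bar P,\bar Q\}\subset\ell_\infty^{++}\setminus\ell_\infty$, $\bar P\ne\bar Q$. The variety-extension $\mathcal V([\mathcal C])^{\star\star}$ contains the two planes $(\!(P)\!)_b$ and $(\!(Q)\!)_b$ of $\Sigma_\infty^{\star\star}$, where $\bar b=\bar\pi\cap\ell_\infty$. Moreover, $\mathcal N_2^{\star\star}\cap\Sigma_\infty^{\star\star}$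 is two points $K,K^q\in\Sigma_\infty^{\star\star}\setminus\Sigma_\infty^{\star}$, with $K$ not on a T-line.
   Context: **$\mathbb F_q$-conics.** An $\mathbb F_q$-subplane of $\mathrm{PG}(2,q^3)$ is a subplane of order $q$; it is secant, tangent or exterior to a line if it meets it in $q+1$, $1$ or $0$ points. An $\mathbb F_q$-conic is a non-degenerate conic of an $\mathbb F_q$-subplane. For an $\mathbb F_q$-conic $\bar{\mathcal C}$, $\bar{\mathcal C}^{+}$ is the unique non-degenerate conic of $\mathrm{PG}(2,q^3)$ containing it, and $\bar{\mathcal C}^{++}$ the unique non-degenerate conic of $\mathrm{PG}(2,q^6)$ containing $\bar{\mathcal C}^+$. A line $\ell_\infty$ of $\mathrm{PG}(2,q^3)$ is fixed as line at infinity; $\ell_\infty^{++}$ is its extension to $\mathrm{PG}(2,q^6)$. **Conjugacy.** For an $\mathbb F_q$-subplane $\bar\pi$, $\bar{\mathsf c}_\pi$ is the collineation $\bar X\mapsto B\bar X^q$ ($B\in\mathrm{GL}(3,q^3)$) of $\mathrm{PG}(2,q^3)$ that has order 3 and fixes $\bar\pi$ pointwise; the same formula defines it on $\mathrm{PG}(2,q^6)$, where it has order 6. Similarly, for an $\mathbb F_q$-subline $\bar b$ of $\ell_\infty$, $\bar{\mathsf c}_b$ is the collineation $\bar X\mapsto D\bar X^q$ of $\ell_\infty$ ($D$ non-singular over $\mathbb F_{q^3}$) of order 3 fixing $\bar b$ pointwise, extended by the same formula to $\ell_\infty^{++}$. **Bose representation.** Embed $\mathrm{PG}(8,q)\subset\mathrm{PG}(8,q^3)\subset\mathrm{PG}(8,q^6)$;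 $X^q$ is obtained by raising coordinates to the $q$-th power. For a subspace or variety $\mathcal K$ given over $\mathbb F_q$ (including a conic), $\mathcal K^\star$ and $\mathcal K^{\star\star}$ denote the pointsets over $\mathbb F_{q^3}$ and $\mathbb F_{q^6}$ of the same equations; for a subspace $\Sigma$ of $\mathrm{PG}(8,q^3)$, $\Sigma^{\star\star}$ is its extension to $\mathrm{PG}(8,q^6)$. Let $\Gamma$ be a plane of $\mathrm{PG}(8,q^3)$ disjoint from $\mathrm{PG}(8,q)$ such that $\Gamma,\Gamma^q,\Gamma^{q^2}$ span $\mathrm{PG}(8,q^3)$. The planes $[\![X]\!]=\langle X,X^q,X^{q^2}\rangle\cap\mathrm{PG}(8,q)$, $X\in\Gamma$, form a regular 2-spread of $\mathrm{PG}(8,q)$. Identify $\mathrm{PG}(2,q^3)$ with $\Gamma$ (and $\mathrm{PG}(2,q^6)$ with $\Gamma^{\star\star}$) by a linear isomorphism, $\bar X\leftrightarrow X$; dropping the bar denotes the corresponding object in $\Gamma$ or $\Gamma^{\star\star}$ (so $\mathcal C,\mathcal C^+,\mathcal C^{++},\mathsf c_\pi,\mathsf c_b$). **Scroll-planes.** For $X\in\Gamma^{\star\star}$, the $\pi$-scroll-plane is $(\!(X)\!)_\pi=\langle X,(X^{\mathsf c_\pi^5})^q,(X^{\mathsf c_\pi^4})^{q^2}\rangle$. **Exact-at-infinity Bruck-Bose representation.** Let $g\subset\Gamma$ be the line corresponding to $\ell_\infty$, $\Sigma_\infty=\langle g,g^q,g^{q^2}\rangle\cap\mathrm{PG}(8,q)$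 (a 5-space), and $\Sigma_{6,q}\cong\mathrm{PG}(6,q)$ a 6-space of $\mathrm{PG}(8,q)$ containing $\Sigma_\infty$ as its hyperplane at infinity. The planes $[\![X]\!]$, $X\in g$, form a regular 2-spread $\mathcal S$ of $\Sigma_\infty$, with transversal lines $g,g^q,g^{q^2}$; its elements are the spread planes. For a point $\bar X$ let $[X]=[\![X]\!]\cap\Sigma_{6,q}$: a point of $\Sigma_{6,q}\setminus\Sigma_\infty$ if $\bar X\notin\ell_\infty$, the spread plane $[\![X]\!]$ if $\bar X\in\ell_\infty$. $[\mathcal C]$ is the set of points lying in the $[X]$, $\bar X\in\bar{\mathcal C}$. For a point $X$ of the extension $g^{\star\star}$ of $g$ to $\mathrm{PG}(8,q^6)$ and an $\mathbb F_q$-subline $\bar b$ of $\ell_\infty$, the $b$-scroll-plane is $(\!(X)\!)_b=\langle X,(X^{\mathsf c_b^5})^q,(X^{\mathsf c_b^4})^{q^2}\rangle\subset\Sigma_\infty^{\star\star}$. A T-line of $\Sigma_\infty^{\star\star}$ is a line meeting two of the extended transversal lines $g^{\star\star},(g^{\star\star})^q,(g^{\star\star})^{q^2}$. **Varieties.** It is known that the pointset of $\{[\![X]\!]:X\in\mathcal C\}$ is an intersection $\mathcal V([\![\mathcal C]\!])$ of nine quadrics of $\mathrm{PG}(8,q)$, that $\mathcal V([\![\mathcal C]\!])^\star$ is the set of points on the planes $(\!(X)\!)_\pi$, $X\in\mathcal C^+$, and $\mathcal V([\![\mathcal C]\!])^{\star\star}$ is the set of points on the planes $(\!(X)\!)_\pi$,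 $X\in\mathcal C^{++}$. Put $\mathcal V([\mathcal C])=\mathcal V([\![\mathcal C]\!])\cap\Sigma_{6,q}$ (its pointset is $[\mathcal C]$), with extensions $\mathcal V([\mathcal C])^\star=\mathcal V([\![\mathcal C]\!])^\star\cap\Sigma_{6,q}^\star$ and $\mathcal V([\mathcal C])^{\star\star}=\mathcal V([\![\mathcal C]\!])^{\star\star}\cap\Sigma_{6,q}^{\star\star}$. *)

theory Defs
  imports "HOL-Analysis.Analysis" "HOL-Number_Theory.Prime_Powers"
begin

(* Everything lives over one ambient field 'a with CARD('a) = q^6.  Its subfields of order q^k,
   for k in {1,3,6}, are {x. x^(q^k) = x}; k = 6 gives 'a itself.  A projective subspace of
   PG(n-1,q^6) is a linear subspace of 'a^'n (projective dimension = vec.dim - 1), and a point is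
   a one-dimensional subspace.  A subspace of PG(n-1,q^k) is represented by its extension to
   PG(n-1,q^6), i.e. by a linear subspace spanned by vectors over the subfield of order q^k; its
   points over the various fields are recovered by pts. *)

definition vecs :: "nat \<Rightarrow> nat \<Rightarrow> ('a::field ^ 'n) set" where
  "vecs q k = {v. \<forall>i. (v $ i) ^ (q ^ k) = v $ i}"

definition mats :: "nat \<Rightarrow> nat \<Rightarrow> ('a::field ^ 'n ^ 'm) set" where
  "mats q k = {M. \<forall>i j. (M $ i $ j) ^ (q ^ k) = M $ i $ j}"

definition PG :: "nat \<Rightarrow> nat \<Rightarrow> ('a::field ^ 'n) set set" where
  "PG q k = {vec.span {v} | v. v \<in> vecs q k \<and> v \<noteq> 0}"

definition pts :: "nat \<Rightarrow> nat \<Rightarrow> ('a::field ^ 'n) set \<Rightarrow> ('a ^ 'n) set set" where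
  "pts q k U = {X \<in> PG q k. X \<subseteq> U}"

definition subspace_over :: "nat \<Rightarrow> nat \<Rightarrow> ('a::field ^ 'n) set \<Rightarrow> bool" where
  "subspace_over q k U \<longleftrightarrow> vec.subspace U \<and> vec.span (U \<inter> vecs q k) = U"

definition line_over :: "nat \<Rightarrow> nat \<Rightarrow> ('a::field ^ 'n) set \<Rightarrow> bool" where
  "line_over q k U \<longleftrightarrow> subspace_over q k U \<and> vec.dim U = 2"

definition plane_over :: "nat \<Rightarrow> nat \<Rightarrow> ('a::field ^ 'n) set \<Rightarrow> bool" where
  "plane_over q k U \<longleftrightarrow> subspace_over q k U \<and> vec.dim U = 3"

(* The map X |-> X^q on vectors; on points and subspaces it acts by taking images. *)
definition frob :: "nat \<Rightarrow> 'a::field ^ 'n \<Rightarrow> 'a ^ 'n" where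
  "frob q v = (\<chi> i. (v $ i) ^ q)"

(* The span of U, U^q and U^(q^2). *)
definition frob_span :: "nat \<Rightarrow> ('a::field ^ 'n) set \<Rightarrow> ('a ^ 'n) set" where
  "frob_span q U = vec.span (U \<union> frob q ` U \<union> frob q ` frob q ` U)"

(* Quadratic forms are given by arbitrary, not necessarily symmetric, coefficient matrices, so
   that characteristic 2 is included. *)
definition qform :: "'a::field ^ 'n ^ 'n \<Rightarrow> 'a ^ 'n \<Rightarrow> 'a" where
  "qform N v = (\<Sum>i\<in>UNIV. \<Sum>j\<in>UNIV. N $ i $ j * v $ i * v $ j)"

definition polar_form :: "'a::field ^ 'n ^ 'n \<Rightarrow> 'a ^ 'n \<Rightarrow> 'a ^ 'n \<Rightarrow> 'a" where
  "polar_form N v w = qform N (v + w) - qform N v - qform N w"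

definition vanishes_at :: "'a::field ^ 'n ^ 'n \<Rightarrow> ('a ^ 'n) set \<Rightarrow> bool" where
  "vanishes_at N X \<longleftrightarrow> (\<forall>v\<in>X. qform N v = 0)"

(* The quadric of U with form N has no singular point, even over the ambient field. *)
definition nondegenerate_on :: "('a::field ^ 'n) set \<Rightarrow> 'a ^ 'n ^ 'n \<Rightarrow> bool" where
  "nondegenerate_on U N \<longleftrightarrow>
     (\<forall>v\<in>U. v \<noteq> 0 \<longrightarrow> qform N v = 0 \<longrightarrow> (\<exists>w\<in>U. polar_form N v w \<noteq> 0))"

(* The points over the field of order q^k of the conic with form N in the plane U.  For U and N
   defined over the field of order q, k = 1 is the conic itself and k = 3, 6 its extensions. *)
definition conic_pts ::
  "nat \<Rightarrow> nat \<Rightarrow> ('a::field ^ 'n) set \<Rightarrow> 'a ^ 'n ^ 'n \<Rightarrow> ('a ^ 'n) set set" where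
  "conic_pts q k U N = {X \<in> pts q k U. vanishes_at N X}"

(* Non-degenerate conics of PG(2,q^k), as pointsets. *)
definition nd_conic :: "nat \<Rightarrow> nat \<Rightarrow> ('a::field ^ 3) set set \<Rightarrow> bool" where
  "nd_conic q k C \<longleftrightarrow>
     (\<exists>N \<in> mats q k. nondegenerate_on UNIV N \<and> C = conic_pts q k UNIV N)"

(* B, with the lines of PG(2,q^3) that meet it in at least two points, is a projective plane
   of order q. *)
definition fq_subplane :: "nat \<Rightarrow> ('a::field ^ 3) set set \<Rightarrow> bool" where
  "fq_subplane q B \<longleftrightarrow>
     B \<subseteq> PG q 3 \<and>
     (\<forall>X\<in>B. \<forall>Y\<in>B. X \<noteq> Y \<longrightarrow> card {Z \<in> B. Z \<subseteq> vec.span (X \<union> Y)} = q + 1) \<and>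
     (\<forall>l m. line_over q 3 l \<and> line_over q 3 m \<and> l \<noteq> m \<and>
        card {Z \<in> B. Z \<subseteq> l} \<ge> 2 \<and> card {Z \<in> B. Z \<subseteq> m} \<ge> 2 \<longrightarrow>
        (\<exists>Z\<in>B. Z \<subseteq> l \<inter> m)) \<and>
     (\<exists>W\<subseteq>B. card W = 4 \<and>
        (\<forall>X\<in>W. \<forall>Y\<in>W. \<forall>Z\<in>W. X \<noteq> Y \<and> Y \<noteq> Z \<and> X \<noteq> Z \<longrightarrow>
           vec.span (X \<union> Y \<union> Z) = UNIV))"

(* A supplies homogeneous coordinates over the field of order q in the subplane B, in which C is
   a non-degenerate conic of PG(2,q). *)
definition fq_conic_in :: "nat \<Rightarrow> ('a::field ^ 3) set set \<Rightarrow> ('a ^ 3) set set \<Rightarrow> bool" where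
  "fq_conic_in q B C \<longleftrightarrow>
     (\<exists>A \<in> mats q 3. invertible A \<and> B = (\<lambda>X. (*v) A ` X) ` PG q 1 \<and>
        (\<exists>C0. nd_conic q 1 C0 \<and> C = (\<lambda>X. (*v) A ` X) ` C0))"

definition order_on :: "nat \<Rightarrow> 'b set \<Rightarrow> ('b \<Rightarrow> 'b) \<Rightarrow> bool" where
  "order_on n S c \<longleftrightarrow>
     (\<forall>X\<in>S. (c ^^ n) X = X) \<and> (\<forall>m. 0 < m \<and> m < n \<longrightarrow> (\<exists>X\<in>S. (c ^^ m) X \<noteq> X))"

(* c is the conjugacy map of the subplane B, on all points of PG(2,q^6). *)
definition subplane_conj ::
  "nat \<Rightarrow> ('a::field ^ 3) set set \<Rightarrow> (('a ^ 3) set \<Rightarrow> ('a ^ 3) set) \<Rightarrow> bool" where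
  "subplane_conj q B c \<longleftrightarrow>
     (\<exists>M \<in> mats q 3. invertible M \<and> (\<forall>X \<in> PG q 6. c X = (\<lambda>v. M *v frob q v) ` X)) \<and>
     order_on 3 (PG q 3) c \<and> (\<forall>X\<in>B. c X = X)"

(* c is the conjugacy map of the subline b of the line L, on all points of L over the field of
   order q^6.  The matrix J supplies homogeneous coordinates over the field of order q^3 on L,
   in which the map is X |-> D X^q. *)
definition subline_conj ::
  "nat \<Rightarrow> ('a::field ^ 3) set \<Rightarrow> ('a ^ 3) set set \<Rightarrow> (('a ^ 3) set \<Rightarrow> ('a ^ 3) set) \<Rightarrow> bool" where
  "subline_conj q L b c \<longleftrightarrow>
     (\<exists>J::'a^2^3. J \<in> mats q 3 \<and> inj ((*v) J) \<and> range ((*v) J) = L \<and>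
        (\<exists>D \<in> mats q 3. invertible D \<and>
           (\<forall>X \<in> pts q 6 L. c X = (\<lambda>y. J *v (D *v frob q y)) ` {y. J *v y \<in> X}))) \<and>
     order_on 3 (pts q 3 L) c \<and> (\<forall>X\<in>b. c X = X)"

(* G is the extension of the plane Gamma of PG(8,q^3) used in the Bose representation. *)
definition bose_plane :: "nat \<Rightarrow> ('a::field ^ 9) set \<Rightarrow> bool" where
  "bose_plane q G \<longleftrightarrow> plane_over q 3 G \<and> pts q 1 G = {} \<and> frob_span q G = UNIV"

(* f identifies PG(2,q^3) with the plane G, and PG(2,q^6) with its extension. *)
definition identification ::
  "nat \<Rightarrow> ('a::field ^ 9) set \<Rightarrow> ('a ^ 3 \<Rightarrow> 'a ^ 9) \<Rightarrow> bool" where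
  "identification q G f \<longleftrightarrow>
     Vector_Spaces.linear (*s) (*s) f \<and> inj f \<and> range f = G \<and> f ` vecs q 3 = G \<inter> vecs q 3"

(* The extension of [[X]], for a point or a line X of PG(2,q^3): the points of [[X]] itself are
   pts q 1 (bose q f X), and for the line at infinity this is the space at infinity. *)
definition bose :: "nat \<Rightarrow> ('a::field ^ 3 \<Rightarrow> 'a ^ 9) \<Rightarrow> ('a ^ 3) set \<Rightarrow> ('a ^ 9) set" where
  "bose q f X = frob_span q (f ` X)"

(* The plane < X, (X^(c^5))^q, (X^(c^4))^(q^2) >: the pi-scroll-plane or the b-scroll-plane of X,
   according to whether c is the conjugacy map of a subplane or of a subline. *)
definition scroll_plane ::
  "nat \<Rightarrow> ('a::field ^ 3 \<Rightarrow> 'a ^ 9) \<Rightarrow> (('a ^ 3) set \<Rightarrow> ('a ^ 3) set) \<Rightarrow> ('a ^ 3) set \<Rightarrow> ('a ^ 9) set"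
  where
  "scroll_plane q f c X =
     vec.span (f ` X \<union> frob q ` f ` (c ^^ 5) X \<union> frob q ` frob q ` f ` (c ^^ 4) X)"

(* The set of spread planes, each given as the set of its points over the field of order q. *)
definition spread ::
  "nat \<Rightarrow> ('a::field ^ 3 \<Rightarrow> 'a ^ 9) \<Rightarrow> ('a ^ 3) set \<Rightarrow> ('a ^ 9) set set set" where
  "spread q f L = (\<lambda>X. pts q 1 (bose q f X)) ` pts q 3 L"

(* A line of the extended space at infinity meeting two of the lines g, g^q, g^(q^2), g = f L. *)
definition T_line ::
  "nat \<Rightarrow> ('a::field ^ 3 \<Rightarrow> 'a ^ 9) \<Rightarrow> ('a ^ 3) set \<Rightarrow> ('a ^ 9) set \<Rightarrow> bool" where
  "T_line q f L T \<longleftrightarrow>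
     line_over q 6 T \<and> T \<subseteq> bose q f L \<and>
     (\<exists>i<3. \<exists>j<3. i \<noteq> j \<and> pts q 6 (T \<inter> ((`) (frob q) ^^ i) (f ` L)) \<noteq> {} \<and>
                      pts q 6 (T \<inter> ((`) (frob q) ^^ j) (f ` L)) \<noteq> {})"

definition nine_quadrics :: "nat \<Rightarrow> (nat \<Rightarrow> 'a::field ^ 9 ^ 9) \<Rightarrow> bool" where
  "nine_quadrics q F \<longleftrightarrow> (\<forall>i<9. F i \<in> mats q 1 \<and> (\<exists>v. qform (F i) v \<noteq> 0))"

(* The points over the field of order q^k of the intersection of the nine quadrics. *)
definition variety_pts :: "nat \<Rightarrow> nat \<Rightarrow> (nat \<Rightarrow> 'a::field ^ 9 ^ 9) \<Rightarrow> ('a ^ 9) set set" where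
  "variety_pts q k F = {X \<in> PG q k. \<forall>i<9. vanishes_at (F i) X}"

(* F is a system of nine quadrics with intersection V([[C]]): its points over the fields of order
   q, q^3, q^6 are those of the planes [[X]], X in C, and of the scroll-planes of the points of
   C+ and of C++ (here Cp and Cpp). *)
definition conic_variety ::
  "nat \<Rightarrow> ('a::field ^ 3 \<Rightarrow> 'a ^ 9) \<Rightarrow> (('a ^ 3) set \<Rightarrow> ('a ^ 3) set) \<Rightarrow>
   ('a ^ 3) set set \<Rightarrow> ('a ^ 3) set set \<Rightarrow> ('a ^ 3) set set \<Rightarrow> (nat \<Rightarrow> 'a ^ 9 ^ 9) \<Rightarrow> bool" where
  "conic_variety q f c C Cp Cpp F \<longleftrightarrow>
     nine_quadrics q F \<and>
     variety_pts q 1 F = (\<Union>X\<in>C. pts q 1 (bose q f X)) \<and>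
     variety_pts q 3 F = (\<Union>X\<in>Cp. pts q 3 (scroll_plane q f c X)) \<and>
     variety_pts q 6 F = (\<Union>X\<in>Cpp. pts q 6 (scroll_plane q f c X))"

(* The points over the field of order q^k of V([C]), the section of V([[C]]) by the 6-space S. *)
definition section_pts ::
  "nat \<Rightarrow> nat \<Rightarrow> (nat \<Rightarrow> 'a::field ^ 9 ^ 9) \<Rightarrow> ('a ^ 9) set \<Rightarrow> ('a ^ 9) set set" where
  "section_pts q k F S = variety_pts q k F \<inter> pts q k S"

end

theory Submission imports Defs "HOL-Number_Theory.Residues" begin

text \<open>Choose coordinates over the subfield of order \<open>q\<^sup>3\<close> in which the subplane consists of the
  points over the subfield of order \<open>q\<close> and the line at infinity is \<open>x\<^sub>3 = 0\<close>. The plane \<open>\<Gamma>\<close> and its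
  two conjugates give coordinates \<open>(x, y, z)\<close> on the nine-dimensional space, in which the Frobenius
  map is \<open>(x, y, z) \<mapsto> (z\<^sup>q, x\<^sup>q, y\<^sup>q)\<close>, and the scroll-plane of a point \<open>x\<close> is the set of all
  \<open>(a x, b x, c x)\<close>. A 6-space through the space at infinity consists of the points whose third
  coordinates \<open>(x\<^sub>3, y\<^sub>3, z\<^sub>3)\<close> are proportional to \<open>(\<delta>, \<delta>\<^sup>q, \<delta>\<^bsup>q\<^sup>2\<^esup>)\<close>, so it meets the scroll-plane of
  an affine point in the single point \<open>(\<delta> x, \<delta>\<^sup>q x, \<delta>\<^bsup>q\<^sup>2\<^esup> x)\<close> and contains the scroll-planes of the
  two points at infinity. The affine points thus form a copy of the conic in a plane. The conic over
  the largest field is determined by its \<open>q + 1 > 4\<close> points over the smallest one, so it has the same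
  equation. If it has no rational point at infinity, the Frobenius map swaps its two points at
  infinity.\<close>

section \<open>Finite fields and the Frobenius map\<close>

text \<open>In the chosen coordinates both conjugacy maps become the Frobenius map, the second one
  on the line at infinity. Its sixth power is the identity, so the exponents 5 and 4 in
  \<open>scroll_plane\<close> undo the powers q and q^2 applied afterwards, and the three vertices
  of a scroll-plane carry one and the same vector x. The obstacle is that the data come as pointsets
  or as maps on points, so vectors and forms are known only up to choices. A conjugacy map is
  identified through the frame that it fixes. The large conic comes with an unknown form over the
  largest field; comparing it with the rational form needs a rational parametrisation, hence a
  rational zero, which odd and even characteristic supply for different reasons. Conversely, the
  conic in the 6-space needs a form in nine variables over \<open>K\<close>, although the geometry
  gives only a ternary one. The section is computed once, on vectors over the largest field; the
  smaller fields merely select rational points.\<close>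

declare One_nat_def [simp del]

text \<open>Not an instance of \<open>finite_field_power_card_eq_same\<close>: the sort \<open>{field, finite}\<close> of a type
  variable does not entail the class \<open>finite_field\<close>.\<close>
lemma power_CARD_eq_same: "(x::'a::{field,finite}) ^ CARD('a) = x"
proof (cases "x = 0")
  case False
  let ?U = "UNIV - {0::'a}"
  have "bij_betw ((*) x) ?U ?U"
    by (rule bij_betw_byWitness[where f' = "(*) (inverse x)"]) (use False in auto)
  then have "prod (\<lambda>y. y) ?U = (\<Prod>y\<in>?U. x * y)"
    using prod.reindex_bij_betw[of "(*) x" ?U ?U "\<lambda>y. y"] by simp
  also have "\<dots> = x ^ card ?U * prod (\<lambda>y. y) ?U"
    by (simp add: prod.distrib)
  finally have "x ^ card ?U = 1" by simp
  moreover have "CARD('a) = Suc (card ?U)"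
    using finite_UNIV_card_ge_0[where ?'a = 'a] by (simp add: card_Diff_singleton)
  then have "x ^ CARD('a) = x * x ^ card ?U"
    by (simp only: power_Suc)
  ultimately show ?thesis by (simp only: mult_1_right)
qed simp

locale frobenius_field =
  fixes q :: nat and K :: "'a::{field,finite} set"
  assumes primepow_q: "primepow q"
    and card_UNIV: "CARD('a) = q ^ 6"
    and K_def: "K = {x. x ^ q = x}"
begin

lemma q_gt_1: "q > 1"
  using primepow_gt_Suc_0[OF primepow_q] by simp

lemma q_pos: "q > 0"
  using q_gt_1 by simp

lemma power_q6 [simp]: "x ^ (q ^ 6) = (x::'a)"
  using power_CARD_eq_same[of x] card_UNIV by simp

lemma add_power_q: "(x + y) ^ q = x ^ q + (y::'a) ^ q"
proof -
  obtain p n where pn: "prime p" "q = p ^ n"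
    using primepow_q unfolding primepow_def by auto
  have "CHAR('a) dvd p ^ (n * 6)"
    using CHAR_dvd_CARD[where 'a = 'a] card_UNIV by (simp add: pn(2) power_mult)
  then obtain i where i: "CHAR('a) = p ^ i"
    using divides_primepow_nat[OF pn(1)] by blast
  have "prime CHAR('a)"
    by (rule prime_CHAR_semidom) (simp add: finite_imp_CHAR_pos)
  with i have "CHAR('a) = p"
    by (metis One_nat_def not_prime_1 power_one_right prime_power_iff)
  then show ?thesis
    using freshmans_dream'[where 'a = 'a, of q n x y] pn by simp
qed

lemma zero_power_q [simp]: "(0::'a) ^ q = 0"
  using q_pos by simp

lemma minus_power_q: "(- x) ^ q = - ((x::'a) ^ q)"
  using add_power_q[of x "- x"] by (simp add: eq_neg_iff_add_eq_0 add.commute)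

lemma diff_power_q: "(x - y) ^ q = x ^ q - (y::'a) ^ q"
  using add_power_q[of x "- y"] by (simp add: minus_power_q)

lemma sum_power_q: "(\<Sum>i\<in>I. g i) ^ q = (\<Sum>i\<in>I. (g i :: 'a) ^ q)"
  by (induction I rule: infinite_finite_induct) (simp_all add: add_power_q)

lemma power_q_eq_iff: "x ^ q = y ^ q \<longleftrightarrow> x = (y::'a)"
proof
  assume "x ^ q = y ^ q"
  then have "(x - y) ^ q = 0"
    by (simp add: diff_power_q)
  then show "x = y" by simp
qed simp

lemma K_iff: "x \<in> K \<longleftrightarrow> x ^ q = x"
  by (simp add: K_def)

lemma K_closed [simp, intro]:
  "0 \<in> K" "1 \<in> K"
  "x \<in> K \<Longrightarrow> - x \<in> K"
  "x \<in> K \<Longrightarrow> inverse x \<in> K"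
  "x \<in> K \<Longrightarrow> y \<in> K \<Longrightarrow> x + y \<in> K"
  "x \<in> K \<Longrightarrow> y \<in> K \<Longrightarrow> x - y \<in> K"
  "x \<in> K \<Longrightarrow> y \<in> K \<Longrightarrow> x * y \<in> K"
  "x \<in> K \<Longrightarrow> y \<in> K \<Longrightarrow> x / y \<in> K"
  by (simp_all add: K_iff add_power_q diff_power_q minus_power_q power_mult_distrib
      power_inverse power_divide)

lemma K_power [simp, intro]: "x \<in> K \<Longrightarrow> x ^ n \<in> K"
  by (induction n) auto

text \<open>Every nonzero \<open>x\<close> outside \<open>K\<close> is a root of the cofactor of \<open>X ^ (q - 1) - 1\<close> in
  \<open>X ^ (q ^ 6 - 1) - 1\<close>, which has degree \<open>q ^ 6 - q\<close>.\<close>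
lemma card_K_ge: "card K \<ge> q"
proof -
  have "int (q - 1) dvd int (q ^ 6 - 1)"
    using q_gt_1 by (auto simp: of_nat_diff power_diff_1_eq)
  then have "q - 1 dvd q ^ 6 - 1"
    by (simp only: of_nat_dvd_iff)
  then obtain m where m: "q ^ 6 - 1 = (q - 1) * m" ..
  define R :: "'a poly" where "R = (\<Sum>i<m. Polynomial.monom 1 ((q - 1) * i))"
  have m0: "m > 0"
  proof (rule ccontr)
    assume "\<not> m > 0"
    then have "q ^ 6 \<le> 1" using m by simp
    moreover have "1 < q ^ 6" using q_gt_1 by (rule one_less_power) simp
    ultimately show False by simp
  qed
  have "Polynomial.coeff R 0 = 1"
    using m0 q_gt_1 by (simp add: R_def coeff_sum if_distrib sum.delta)
  then have R0: "R \<noteq> 0" by auto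
  have "degree R \<le> (q - 1) * (m - 1)"
    unfolding R_def
  proof (rule degree_sum_le)
    fix i assume "i \<in> {..<m}"
    then show "degree (Polynomial.monom (1::'a) ((q - 1) * i)) \<le> (q - 1) * (m - 1)"
      by (intro order_trans[OF degree_monom_le] mult_le_mono) auto
  qed simp
  also have "(q - 1) * (m - 1) = q ^ 6 - q"
    using m q_gt_1 by (simp add: right_diff_distrib')
  finally have roots: "card {x. poly R x = 0} \<le> q ^ 6 - q"
    using card_poly_roots_bound[OF R0] by linarith
  have "UNIV - {x. poly R x = 0} \<subseteq> K"
  proof
    fix x assume "x \<in> UNIV - {x. poly R x = 0}"
    then have Rx: "poly R x \<noteq> 0" by simp
    have Rx': "poly R x = (\<Sum>i<m. (x ^ (q - 1)) ^ i)"
      by (simp add: R_def poly_sum poly_monom power_mult)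
    show "x \<in> K"
    proof (cases "x = 0")
      case False
      have "x * x ^ (q ^ 6 - 1) = x"
        using power_q6[of x] q_pos by (metis power_eq_if nat_zero_less_power_iff neq0_conv)
      then have "x ^ (q ^ 6 - 1) = 1"
        using False by simp
      then have "(x ^ (q - 1) - 1) * poly R x = 0"
        unfolding Rx' by (simp add: power_diff_1_eq[symmetric] m power_mult)
      then have "x ^ (q - 1) = 1" using Rx by simp
      then show ?thesis
        using q_pos by (simp add: K_iff power_eq_if)
    qed simp
  qed
  then have "card (UNIV - {x. poly R x = 0}) \<le> card K"
    by (intro card_mono) auto
  then show ?thesis
    using roots q_gt_1 self_le_power[of q 6] by (simp add: card_Diff_subset card_UNIV)
qed

section \<open>Frobenius on vectors, spans and points\<close>

lemma frob_nth [simp]: "frob q v $ i = (v $ i :: 'a) ^ q"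
  by (simp add: frob_def)

lemma frob_add: "frob q (v + w) = frob q v + frob q (w :: 'a ^ 'n)"
  by (simp add: vec_eq_iff add_power_q)

lemma frob_scale: "frob q (c *s v) = (c ^ q) *s frob q (v :: 'a ^ 'n)"
  by (simp add: vec_eq_iff power_mult_distrib)

lemma frob_0 [simp]: "frob q (0 :: 'a ^ 'n) = 0"
  by (simp add: vec_eq_iff)

lemma frob_sum: "frob q (sum g I) = (\<Sum>i\<in>I. frob q (g i :: 'a ^ 'n))"
  by (induction I rule: infinite_finite_induct) (simp_all add: frob_add)

lemma frob_eq_iff [simp]: "frob q v = frob q w \<longleftrightarrow> v = (w :: 'a ^ 'n)"
  by (simp add: vec_eq_iff power_q_eq_iff)

lemma frob_eq_0_iff [simp]: "frob q v = 0 \<longleftrightarrow> v = (0 :: 'a ^ 'n)"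
  using frob_eq_iff[of v 0] by simp

lemma frob_axis [simp]: "frob q (axis i 1 :: 'a ^ 'n) = axis i 1"
  by (simp add: vec_eq_iff axis_def)

lemma frob_iter_nth: "((frob q ^^ k) v) $ i = (v $ i :: 'a) ^ (q ^ k)"
  by (induction k) (simp_all add: mult.commute[of q] flip: power_mult)

lemma frob_6: "frob q (frob q (frob q (frob q (frob q (frob q v))))) = (v :: 'a ^ 'n)"
proof -
  have "(frob q ^^ 6) v = v"
    by (simp add: vec_eq_iff frob_iter_nth)
  then show ?thesis by (simp add: numeral_eq_Suc One_nat_def)
qed

lemma frob_iter_eq_0_iff [simp]: "(frob q ^^ k) v = 0 \<longleftrightarrow> v = (0 :: 'a ^ 'n)"
  by (induction k) simp_all

lemma frob_iter_scale: "(frob q ^^ k) (c *s v) = (c ^ (q ^ k)) *s (frob q ^^ k) (v :: 'a ^ 'n)"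
  by (simp add: vec_eq_iff frob_iter_nth power_mult_distrib)

lemma frob_iter_sum: "(frob q ^^ k) (sum g I) = (\<Sum>i\<in>I. (frob q ^^ k) (g i :: 'a ^ 'n))"
  by (induction k) (simp_all add: frob_sum)

lemma in_vecs_iff: "v \<in> vecs q k \<longleftrightarrow> (frob q ^^ k) v = (v :: 'a ^ 'n)"
  by (simp add: vecs_def vec_eq_iff frob_iter_nth)

lemma in_vecs_1_iff: "v \<in> vecs q 1 \<longleftrightarrow> frob q v = (v :: 'a ^ 'n)"
  by (simp add: in_vecs_iff One_nat_def)

lemma in_vecs_1_iff_K: "v \<in> vecs q 1 \<longleftrightarrow> (\<forall>i. (v $ i :: 'a) \<in> K)"
  by (simp add: vecs_def K_iff)

lemma in_vecs_6 [simp]: "(v :: 'a ^ 'n) \<in> vecs q 6"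
  by (simp add: vecs_def)

lemma span_1: "vec.span {v :: 'a ^ 'n} = range (\<lambda>c. c *s v)"
  by (rule vec.span_singleton)

lemma span_1_eq_iff:
  assumes "v \<noteq> 0" "w \<noteq> (0 :: 'a ^ 'n)"
  shows "vec.span {v} = vec.span {w} \<longleftrightarrow> v \<in> vec.span {w}"
proof
  assume "v \<in> vec.span {w}"
  then obtain c where c: "v = c *s w" by (auto simp: span_1)
  then have "c \<noteq> 0" using assms by auto
  then have "w = inverse c *s v" using c by simp
  then show "vec.span {v} = vec.span {w}"
    unfolding vec.span_eq using c by (auto simp: span_1)
qed (auto intro: vec.span_base)

lemma surj_power_q: "\<exists>c. (b::'a) = c ^ q"
proof -
  have "inj (\<lambda>c::'a. c ^ q)" by (rule injI) (simp add: power_q_eq_iff)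
  then have "surj (\<lambda>c::'a. c ^ q)" by (rule finite_UNIV_inj_surj[OF finite])
  then show ?thesis by (metis surjD)
qed

lemma frob_image_span_1: "frob q ` vec.span {v :: 'a ^ 'n} = vec.span {frob q v}"
proof -
  have "c *s frob q v \<in> frob q ` range (\<lambda>c. c *s v)" for c
    using surj_power_q[of c] by (auto simp: frob_scale image_iff)
  then show ?thesis
    unfolding span_1 by (auto simp: frob_scale)
qed

lemma frob_iter_image_span_1:
  "((`) (frob q) ^^ k) (vec.span {v :: 'a ^ 'n}) = vec.span {(frob q ^^ k) v}"
  by (induction k) (simp_all add: frob_image_span_1)

lemma image_span_1:
  assumes "Vector_Spaces.linear (*s) (*s) (g :: 'a ^ 'n \<Rightarrow> 'a ^ 'm)"
  shows "g ` vec.span {v} = vec.span {g v}"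
  using assms by (subst vec.linear_span_image[symmetric]) simp_all

text \<open>The coordinates of x in the standard basis are raised to the power q^k, while the
  rational images of the basis vectors stay fixed. With k = 3 this also expresses that a
  parametrisation of the plane Gamma is defined over the subfield of order q^3.\<close>

lemma frob_iter_linear:
  fixes g :: "'a ^ 'n \<Rightarrow> 'a ^ 'm"
  assumes g: "Vector_Spaces.linear (*s) (*s) g" and "\<And>i. g (axis i 1) \<in> vecs q k"
  shows "(frob q ^^ k) (g x) = g ((frob q ^^ k) x)"
proof -
  have e: "g x = (\<Sum>i\<in>UNIV. x $ i *s g (axis i 1))" for x
  proof -
    have "g x = g (\<Sum>i\<in>UNIV. x $ i *s axis i 1)" by (simp only: basis_expansion)
    then show ?thesis by (simp only: vec.linear_sum[OF g] vec.linear_scale[OF g])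
  qed
  show ?thesis
    using assms(2) unfolding e[of x] e[of "(frob q ^^ k) x"] by (simp add: frob_iter_sum frob_iter_scale frob_iter_nth in_vecs_iff)
qed

lemma frob_iter_mats:
  assumes "(M :: 'a ^ 'n ^ 'm) \<in> mats q k"
  shows "(frob q ^^ k) (M *v x) = M *v ((frob q ^^ k) x)"
proof (rule frob_iter_linear)
  show "M *v axis i 1 \<in> vecs q k" for i
    using assms by (simp add: mats_def vecs_def matrix_vector_mult_def axis_def if_distrib cong: if_cong)
qed simp

lemma mats_1_iff: "(M :: 'a ^ 'n ^ 'm) \<in> mats q 1 \<longleftrightarrow> (\<forall>i j. M $ i $ j \<in> K)"
  by (simp add: mats_def K_iff)

text \<open>Hilbert 90 for points: rescale one coordinate to 1.\<close>
lemma frob_fixed_point: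
  fixes v :: "'a ^ 'n"
  assumes "v \<noteq> 0" "frob q v \<in> vec.span {v}"
  obtains c where "c \<noteq> 0" "c *s v \<in> vecs q 1"
proof -
  obtain i where i: "v $ i \<noteq> 0"
    using assms(1) by (auto simp: vec_eq_iff)
  obtain \<mu> where \<mu>: "frob q v = \<mu> *s v"
    using assms(2) by (auto simp: span_1)
  have n: "(v $ j) ^ q = \<mu> * v $ j" for j
    using \<mu> by (simp add: vec_eq_iff)
  have "\<mu> \<noteq> 0" using n[of i] i by auto
  have "frob q (inverse (v $ i) *s v) = inverse (v $ i) *s v"
    using i \<open>\<mu> \<noteq> 0\<close> by (simp add: vec_eq_iff n power_mult_distrib power_inverse)
  then show ?thesis
    using that[of "inverse (v $ i)"] i by (simp add: in_vecs_1_iff)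
qed

lemma PG_memD: "vec.span {v :: 'a ^ 'n} \<in> PG q k \<Longrightarrow> (frob q ^^ k) v \<in> vec.span {v}"
proof -
  assume "vec.span {v} \<in> PG q k"
  then obtain w where w: "w \<in> vecs q k" "vec.span {v} = vec.span {w}"
    unfolding PG_def by blast
  then have "v \<in> vec.span {w}" using vec.span_base[of v "{v}"] by simp
  then obtain c where "v = c *s w" by (auto simp: span_1)
  then have "(frob q ^^ k) v = c ^ (q ^ k) *s w"
    using w(1) by (simp add: frob_iter_scale in_vecs_iff)
  then show ?thesis unfolding w(2) by (auto simp: span_1)
qed

text \<open>A vector spanning a rational point need not be rational itself. By
  \<open>frob_fixed_point\<close> some nonzero multiple is, so rationality can be tested on any
  representative.\<close>

lemma PG_1_iff:
  assumes "v \<noteq> (0 :: 'a ^ 'n)"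
  shows "vec.span {v} \<in> PG q 1 \<longleftrightarrow> frob q v \<in> vec.span {v}"
proof
  assume "frob q v \<in> vec.span {v}"
  then obtain c where "c \<noteq> 0" "c *s v \<in> vecs q 1"
    using frob_fixed_point[OF assms] by blast
  moreover from \<open>c \<noteq> 0\<close> have "vec.span {c *s v} = vec.span {v}"
    using assms by (subst span_1_eq_iff) (auto simp: span_1)
  ultimately show "vec.span {v} \<in> PG q 1"
    unfolding PG_def using assms by (metis (mono_tags, lifting) mem_Collect_eq vector_mul_eq_0)
qed (use PG_memD[of v 1] in \<open>simp add: One_nat_def\<close>)

lemma PG_6: "X \<in> PG q 6 \<longleftrightarrow> (\<exists>v. v \<noteq> (0 :: 'a ^ 'n) \<and> X = vec.span {v})"
  by (auto simp: PG_def)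

lemma PG_subset_PG_6: "PG q k \<subseteq> (PG q 6 :: ('a ^ 'n) set set)"
  by (auto simp: PG_def)

text \<open>Uniqueness of a semilinear map fixing a frame: fixed axis points make it diagonal, and
  the fixed unit point makes the diagonal entries equal. The index set \<open>I\<close> lets one
  argument serve the whole plane and the line where the third coordinate vanishes.\<close>

lemma semilinear_eq_scaled_frob:
  fixes m :: "'a ^ 'n \<Rightarrow> 'a ^ 'n"
  assumes add: "\<And>x y. m (x + y) = m x + m y"
    and scale: "\<And>c x. m (c *s x) = c ^ q *s m x"
    and basis: "\<And>i. i \<in> I \<Longrightarrow> m (axis i 1) \<in> vec.span {axis i 1}"
    and unit: "m (\<Sum>i\<in>I. axis i 1) \<in> vec.span {\<Sum>i\<in>I. axis i 1}"
  obtains \<mu> where "\<And>x. (\<And>i. i \<notin> I \<Longrightarrow> x $ i = 0) \<Longrightarrow> m x = \<mu> *s frob q x"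
proof -
  have m0: "m 0 = 0" using scale[of 0 0] q_pos by simp
  have msum: "m (sum g J) = (\<Sum>i\<in>J. m (g i))" for g and J :: "'n set"
    by (induction J rule: infinite_finite_induct) (simp_all add: m0 add)
  have "\<forall>i\<in>I. \<exists>l. m (axis i 1) = l *s axis i 1"
    using basis by (auto simp: span_1)
  then obtain l where l: "\<And>i. i \<in> I \<Longrightarrow> m (axis i 1) = l i *s axis i 1" by metis
  obtain \<mu> where \<mu>: "m (\<Sum>i\<in>I. axis i 1) = \<mu> *s (\<Sum>i\<in>I. axis i 1)"
    using unit by (auto simp: span_1)
  have l\<mu>: "l i = \<mu>" if "i \<in> I" for i
  proof -
    have "(\<Sum>j\<in>I. l j *s axis j 1) $ i = (\<mu> *s (\<Sum>j\<in>I. axis j (1::'a))) $ i"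
      using \<mu> by (simp add: msum l)
    then show ?thesis using that by (simp add: axis_def if_distrib sum.delta cong: if_cong)
  qed
  show ?thesis
  proof
    fix x :: "'a ^ 'n" assume x: "\<And>i. i \<notin> I \<Longrightarrow> x $ i = 0"
    have "x = (\<Sum>i\<in>UNIV. x $ i *s axis i 1)" by (rule basis_expansion[symmetric])
    also have "\<dots> = (\<Sum>i\<in>I. x $ i *s axis i 1)"
      by (rule sum.mono_neutral_right) (auto simp: x)
    finally have xI: "x = (\<Sum>i\<in>I. x $ i *s axis i 1)" .
    have "m x = (\<Sum>i\<in>I. (x $ i) ^ q *s (\<mu> *s axis i 1))"
      by (subst xI) (simp add: msum scale l l\<mu> del: vector_smult_assoc)
    also have "\<dots> = \<mu> *s frob q (\<Sum>i\<in>I. x $ i *s axis i 1)"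
      by (simp add: frob_sum frob_scale vec.scale_sum_right mult.commute)
    finally show "m x = \<mu> *s frob q x" using xI by simp
  qed
qed

end

section \<open>Ternary quadratic forms\<close>

text \<open>The bilinear form of a possibly non-symmetric coefficient matrix. Its diagonal is
  \<open>qform\<close> and its symmetrisation is \<open>polar_form\<close>, so both inherit their
  rules from bilinearity in every characteristic.\<close>

definition bform :: "'a::field ^ 'n ^ 'n \<Rightarrow> 'a ^ 'n \<Rightarrow> 'a ^ 'n \<Rightarrow> 'a" where
  "bform N v w = (\<Sum>i\<in>UNIV. v $ i * (N *v w) $ i)"

lemma bform_add_left: "bform N (u + v) w = bform N u w + bform N v w"
  by (simp add: bform_def distrib_right sum.distrib)

lemma bform_add_right: "bform N u (v + w) = bform N u v + bform N u w"
  by (simp add: bform_def distrib_left sum.distrib matrix_vector_right_distrib)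

lemma bform_scale_left: "bform N (c *s v) w = c * bform N v w"
  by (simp add: bform_def sum_distrib_left mult.assoc)

lemma bform_scale_right: "bform N v (c *s w) = c * bform N v w"
  by (simp add: bform_def sum_distrib_left mult.left_commute vector_scalar_commute)

lemma bform_congruence: "bform (transpose R ** N ** R) v w = bform N (R *v v) (R *v w)"
proof -
  have "bform (transpose R ** N ** R) v w = (\<Sum>i\<in>UNIV. v $ i * (transpose R *v (N *v (R *v w))) $ i)"
    by (simp add: bform_def matrix_vector_mul_assoc matrix_mul_assoc)
  also have "\<dots> = (\<Sum>i\<in>UNIV. \<Sum>j\<in>UNIV. v $ i * (R $ j $ i * (N *v (R *v w)) $ j))"
    unfolding matrix_vector_mult_def[of "transpose R"] by (simp add: transpose_def sum_distrib_left)
  also have "\<dots> = (\<Sum>j\<in>UNIV. \<Sum>i\<in>UNIV. v $ i * (R $ j $ i * (N *v (R *v w)) $ j))"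
    by (rule sum.swap)
  also have "\<dots> = bform N (R *v v) (R *v w)"
    by (simp add: bform_def matrix_vector_mult_def[of R v] sum_distrib_left sum_distrib_right mult_ac)
  finally show ?thesis .
qed

lemma qform_bform: "qform N v = bform N v v"
  by (simp add: qform_def bform_def matrix_vector_mult_def sum_distrib_left mult_ac)

lemma polar_bform: "polar_form N v w = bform N v w + bform N w v"
  by (simp add: polar_form_def qform_bform bform_add_left bform_add_right)

lemma qform_congruence: "qform (transpose R ** N ** R) v = qform N (R *v v)"
  by (simp add: qform_bform bform_congruence)

lemma polar_congruence: "polar_form (transpose R ** N ** R) v w = polar_form N (R *v v) (R *v w)"
  by (simp add: polar_bform bform_congruence)

lemma qform_scale: "qform N (c *s v) = c\<^sup>2 * qform N v"
  by (simp add: qform_bform bform_scale_left bform_scale_right power2_eq_square)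

lemma qform_0 [simp]: "qform N 0 = 0"
  using qform_scale[of N 0 0] by simp

lemma qform_add: "qform N (v + w) = qform N v + qform N w + polar_form N v w"
  by (simp add: polar_form_def)

lemma polar_linear:
  "polar_form N (u + v) w = polar_form N u w + polar_form N v w"
  "polar_form N w (u + v) = polar_form N w u + polar_form N w v"
  "polar_form N (c *s v) w = c * polar_form N v w"
  "polar_form N w (c *s v) = c * polar_form N w v"
  by (simp_all add: polar_bform bform_add_left bform_add_right bform_scale_left bform_scale_right
      distrib_left)

lemma polar_commute: "polar_form N v w = polar_form N w v"
  by (simp add: polar_bform)

lemma polar_self: "polar_form N v v = 2 * qform N v"
  by (simp add: polar_bform qform_bform)

lemma qform_comb3:
  "qform N (x *s p + y *s v + z *s w) =
     x\<^sup>2 * qform N p + y\<^sup>2 * qform N v + z\<^sup>2 * qform N w +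
     x * y * polar_form N p v + x * z * polar_form N p w + y * z * polar_form N v w"
  by (simp add: qform_add qform_scale polar_linear algebra_simps)

text \<open>A vector found in this way is rational, so it completes two independent rational vectors
  to a rational basis.\<close>

lemma axis_notin_span_pair: "\<exists>j. axis j 1 \<notin> vec.span {v, w :: 'a::field ^ 3}"
proof (rule ccontr)
  assume "\<not> ?thesis"
  then have "u \<in> vec.span {v, w}" for u
    by (subst basis_expansion[of u, symmetric]) (auto intro!: vec.span_sum vec.span_scale)
  then have "vec.span {v, w} = UNIV" by blast
  moreover have "vec.dim (vec.span {v, w}) \<le> 2"
    using vec.dim_le_card[of "vec.span {v, w}" "{v, w}"]
    by (simp add: card_insert_if split: if_splits)
  ultimately have "CARD(3) \<le> 2" by (simp only: vec_dim_card)
  then show False by simp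
qed

lemma vanishes_at_span_1: "vanishes_at N (vec.span {v}) \<longleftrightarrow> qform N v = 0"
  by (auto simp: vanishes_at_def vec.span_singleton qform_scale dest!: spec[of _ 1])

lemma nondegenerate_on_congruence:
  assumes "nondegenerate_on UNIV N" "bij ((*v) R)"
  shows "nondegenerate_on UNIV (transpose R ** N ** R)"
proof -
  have "\<exists>w. polar_form N (R *v v) (R *v w) \<noteq> 0" if v: "v \<noteq> 0" "qform N (R *v v) = 0" for v
  proof -
    have "R *v v \<noteq> R *v 0"
      using v(1) injD[OF bij_is_inj[OF assms(2)]] by blast
    then obtain u where "polar_form N (R *v v) u \<noteq> 0"
      using assms(1) v(2) by (auto simp: nondegenerate_on_def)
    then show ?thesis
      using assms(2) by (metis bij_pointE)
  qed
  then show ?thesis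
    by (simp add: nondegenerate_on_def qform_congruence polar_congruence)
qed

section \<open>Rational zeros and normal forms of ternary quadratic forms\<close>

context frobenius_field
begin

lemma vecs_1_closed:
  "v \<in> vecs q 1 \<Longrightarrow> w \<in> vecs q 1 \<Longrightarrow> v + w \<in> (vecs q 1 :: ('a ^ 'n) set)"
  "v \<in> vecs q 1 \<Longrightarrow> w \<in> vecs q 1 \<Longrightarrow> v - w \<in> (vecs q 1 :: ('a ^ 'n) set)"
  "c \<in> K \<Longrightarrow> v \<in> vecs q 1 \<Longrightarrow> c *s v \<in> (vecs q 1 :: ('a ^ 'n) set)"
  "axis i 1 \<in> (vecs q 1 :: ('a ^ 'n) set)"
  by (auto simp: in_vecs_1_iff_K axis_def)

lemma sum_K: "(\<And>i. i \<in> I \<Longrightarrow> g i \<in> K) \<Longrightarrow> sum g I \<in> K"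
  by (induction I rule: infinite_finite_induct) auto

lemma qform_K:
  assumes "N \<in> mats q 1" "v \<in> vecs q 1"
  shows "qform N (v :: 'a ^ 'n) \<in> K"
  using assms unfolding qform_def mats_1_iff in_vecs_1_iff_K by (intro sum_K K_closed) auto

lemma polar_K:
  assumes "N \<in> mats q 1" "v \<in> vecs q 1" "w \<in> vecs q 1"
  shows "polar_form N v (w :: 'a ^ 'n) \<in> K"
  unfolding polar_form_def using assms by (intro K_closed qform_K vecs_1_closed) auto

lemma qform_frob:
  assumes "N \<in> mats q 1"
  shows "qform N (frob q v) = (qform N v :: 'a) ^ q"
  using assms by (simp add: qform_def sum_power_q power_mult_distrib mats_1_iff K_iff)

text \<open>Squaring is at most two-to-one on the nonzero elements, and 0 is a square with a single
  root. Hence the squares fill more than half of \<open>K\<close>.\<close>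

lemma card_squares: "2 * card ((\<lambda>x. x\<^sup>2) ` K) \<ge> card K + 1"
proof -
  let ?S = "(\<lambda>x. x\<^sup>2) ` K"
  have fib: "card {x \<in> K. x\<^sup>2 = s} \<le> 2" for s
  proof (cases "\<exists>x0. x0\<^sup>2 = s")
    case True
    then obtain x0 where "x0\<^sup>2 = s" by blast
    then have "{x \<in> K. x\<^sup>2 = s} \<subseteq> {x0, - x0}"
      by (auto simp: power2_eq_iff)
    then have "card {x \<in> K. x\<^sup>2 = s} \<le> card {x0, - x0}"
      by (intro card_mono) auto
    then show ?thesis by (simp add: card_insert_if split: if_splits)
  qed simp
  have "K - {0} \<subseteq> (\<Union>s\<in>?S - {0}. {x \<in> K. x\<^sup>2 = s})"
    by auto
  then have "card (K - {0}) \<le> card (\<Union>s\<in>?S - {0}. {x \<in> K. x\<^sup>2 = s})"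
    by (intro card_mono) auto
  also have "\<dots> \<le> (\<Sum>s\<in>?S - {0}. card {x \<in> K. x\<^sup>2 = s})"
    by (rule card_UN_le) simp
  also have "\<dots> \<le> card (?S - {0}) * 2"
    using sum_bounded_above[of "?S - {0}" "\<lambda>s. card {x \<in> K. x\<^sup>2 = s}" 2] fib by simp
  finally have "card (K - {0}) \<le> 2 * card (?S - {0})" by simp
  moreover have "0 \<in> ?S" by (auto intro!: image_eqI[of _ _ 0])
  moreover have "card K > 0" "card ?S > 0"
    by (auto simp: card_gt_0_iff intro: K_closed(1))
  ultimately show ?thesis
    by (simp add: card_Diff_singleton)
qed

text \<open>Pigeonhole: the values of \<alpha> x^2 and of - \<gamma> - \<beta> y^2 each fill more
  than half of \<open>K\<close>, so they share one.\<close>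

lemma diagonal_ternary_isotropic:
  assumes "\<alpha> \<in> K" "\<beta> \<in> K" "\<gamma> \<in> K" "\<alpha> \<noteq> 0" "\<beta> \<noteq> 0"
  obtains x y where "x \<in> K" "y \<in> K" "\<alpha> * x\<^sup>2 + \<beta> * y\<^sup>2 + \<gamma> = 0"
proof -
  let ?S = "(\<lambda>x. x\<^sup>2) ` K"
  let ?A = "(\<lambda>s. \<alpha> * s) ` ?S" and ?B = "(\<lambda>s. - \<gamma> - \<beta> * s) ` ?S"
  have "card ?A = card ?S" "card ?B = card ?S"
    using assms(4,5) by (auto intro!: card_image inj_onI)
  then have "card ?A + card ?B > card K"
    using card_squares by simp
  moreover have "?A \<union> ?B \<subseteq> K"
    using assms by auto
  then have "card (?A \<union> ?B) \<le> card K"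
    by (intro card_mono) auto
  ultimately have "?A \<inter> ?B \<noteq> {}"
    using card_Un_disjoint[of ?A ?B] by auto
  then obtain x y where "x \<in> K" "y \<in> K" "\<alpha> * x\<^sup>2 = - \<gamma> - \<beta> * y\<^sup>2" by auto
  then show ?thesis using that[of x y] by simp
qed

lemma polar_3:
  fixes N :: "'a ^ 3 ^ 3"
  shows "polar_form N v w =
    2 * (N $ 1 $ 1 * v $ 1 * w $ 1 + N $ 2 $ 2 * v $ 2 * w $ 2 + N $ 3 $ 3 * v $ 3 * w $ 3) +
    (N $ 1 $ 2 + N $ 2 $ 1) * (v $ 1 * w $ 2 + v $ 2 * w $ 1) +
    (N $ 1 $ 3 + N $ 3 $ 1) * (v $ 1 * w $ 3 + v $ 3 * w $ 1) +
    (N $ 2 $ 3 + N $ 3 $ 2) * (v $ 2 * w $ 3 + v $ 3 * w $ 2)"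
  by (simp add: polar_form_def qform_def sum_3) (simp add: algebra_simps)

text \<open>In characteristic 2 the polar form is alternating, so in three variables it has a
  radical vector r, the nucleus of the conic. Along r the form is additive: Q(u + t r) = Q(u) + t^2
  Q(r). Every element of \<open>K\<close> is a square here, so unless r itself is a zero, t can be
  solved for; choosing u off the span of r keeps the solution nonzero.\<close>

lemma char_2_isotropic:
  fixes N :: "'a ^ 3 ^ 3"
  assumes N: "N \<in> mats q 1" and two: "(2::'a) = 0"
  obtains v where "v \<in> vecs q 1" "v \<noteq> 0" "qform N v = 0"
proof -
  \<comment> \<open>The polar coefficients in complementary order, like a cross product: pairing
    \<open>r0\<close> with any vector produces each term twice. If all of them vanish, the polar
    form is zero and any vector serves as radical vector.\<close>
  define r0 :: "'a ^ 3" where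
    "r0 = vector [N $ 2 $ 3 + N $ 3 $ 2, N $ 1 $ 3 + N $ 3 $ 1, N $ 1 $ 2 + N $ 2 $ 1]"
  define r :: "'a ^ 3" where "r = (if r0 = 0 then axis 1 1 else r0)"
  have r_rad: "polar_form N r w = 0" for w
  proof (cases "r0 = 0")
    case True
    then have "r0 $ 1 = 0" "r0 $ 2 = 0" "r0 $ 3 = 0" by simp_all
    then show ?thesis by (simp add: r0_def polar_3 two)
  next
    case False
    have "polar_form N r0 w =
        2 * (r0 $ 1 * r0 $ 3 * w $ 2 + r0 $ 2 * r0 $ 3 * w $ 1 + r0 $ 1 * r0 $ 2 * w $ 3)"
      by (simp add: polar_3 two r0_def) (simp add: two algebra_simps)
    then show ?thesis using False by (simp add: r_def two)
  qed
  have r: "r \<in> vecs q 1" "r \<noteq> 0"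
  proof -
    have "r0 \<in> vecs q 1"
      using N by (simp add: r0_def mats_1_iff in_vecs_1_iff_K forall_3)
    then show "r \<in> vecs q 1" by (simp add: r_def vecs_1_closed)
    show "r \<noteq> 0" by (simp add: r_def)
  qed
  show ?thesis
  proof (cases "qform N r = 0")
    case True
    then show ?thesis using that r by blast
  next
    case False
    have ex: "\<exists>u \<in> vecs q 1. u \<notin> vec.span {r}"
    proof (rule ccontr)
      assume "\<not> ?thesis"
      then have a: "axis 1 1 \<in> vec.span {r}" "axis 2 1 \<in> vec.span {r}"
        using vecs_1_closed(4) by blast+
      then obtain c d where c: "axis 1 1 = c *s r" and d: "axis 2 1 = d *s r"
        by (auto simp: span_1)
      have "c * r $ 1 = 1" "c * r $ 2 = 0" "d * r $ 1 = 0" "d * r $ 2 = 1"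
        using c d by (auto simp: vec_eq_iff forall_3 axis_def dest: sym)
      then show False by auto
    qed
    then obtain u where u: "u \<in> vecs q 1" "u \<notin> vec.span {r}" by blast
    have "inj_on (\<lambda>x. x\<^sup>2) K"
    proof (rule inj_onI)
      fix x y :: 'a assume "x\<^sup>2 = y\<^sup>2"
      then have "(x - y)\<^sup>2 = 2 * (y\<^sup>2 - x * y)"
        by (simp add: power2_diff algebra_simps)
      then show "x = y" by (simp add: two)
    qed
    then have "(\<lambda>x. x\<^sup>2) ` K = K"
      by (intro endo_inj_surj) auto
    moreover have "- (qform N u / qform N r) \<in> K"
      using N u(1) r(1) by (auto intro: qform_K)
    ultimately obtain t where t: "t \<in> K" "t\<^sup>2 = - (qform N u / qform N r)"
      by (metis (no_types, lifting) imageE)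
    have "qform N (u + t *s r) = 0"
      using False by (simp add: qform_add qform_scale polar_linear polar_commute[of N u r] r_rad t)
    moreover have "u + t *s r \<noteq> 0"
    proof
      assume "u + t *s r = 0"
      then have "u = (- t) *s r" by (simp add: eq_neg_iff_add_eq_0)
      then show False using u(2) vec.span_scale[OF vec.span_base[of r "{r}"], of "- t"] by simp
    qed
    ultimately show ?thesis
      using that[of "u + t *s r"] u r t by (simp add: vecs_1_closed)
  qed
qed

text \<open>Gram-Schmidt reduces the form to a diagonal one. Arguing by contradiction makes this
  possible: if the form has no rational zero, then \<alpha> and \<beta> are nonzero and the
  divisions by 2 \<alpha> and 2 \<beta> are legitimate. The diagonal form then has a zero with third
  coefficient 1.\<close>

lemma odd_char_isotropic:
  fixes N :: "'a ^ 3 ^ 3"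
  assumes N: "N \<in> mats q 1" and two: "(2::'a) \<noteq> 0"
  obtains v where "v \<in> vecs q 1" "v \<noteq> 0" "qform N v = 0"
proof (rule ccontr)
  assume "\<not> thesis"
  then have an: "\<And>v. v \<in> vecs q 1 \<Longrightarrow> v \<noteq> 0 \<Longrightarrow> qform N v \<noteq> 0" using that by blast
  define e1 :: "'a ^ 3" where "e1 = axis 1 1"
  define \<alpha> where "\<alpha> = qform N e1"
  define f2 :: "'a ^ 3" where "f2 = axis 2 1 - (polar_form N e1 (axis 2 1) / (2 * \<alpha>)) *s e1"
  define \<beta> where "\<beta> = qform N f2"
  define f3 :: "'a ^ 3" where "f3 = axis 3 1 - (polar_form N e1 (axis 3 1) / (2 * \<alpha>)) *s e1
    - (polar_form N f2 (axis 3 1) / (2 * \<beta>)) *s f2"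
  define \<gamma> where "\<gamma> = qform N f3"
  have K2: "2 \<in> K" using K_closed(5)[OF K_closed(2) K_closed(2)] by simp
  have e1: "e1 \<in> vecs q 1" unfolding e1_def by (rule vecs_1_closed)
  have \<alpha>: "\<alpha> \<in> K" "\<alpha> \<noteq> 0"
    unfolding \<alpha>_def using an[OF e1] e1 N by (auto simp: e1_def intro: qform_K)
  have f2: "f2 \<in> vecs q 1" "f2 $ 2 = 1" "f2 $ 3 = 0"
  proof -
    show "f2 \<in> vecs q 1"
      unfolding f2_def using N e1 \<alpha> K2 by (intro vecs_1_closed K_closed polar_K)
  qed (simp_all add: f2_def e1_def axis_def)
  then have "f2 \<noteq> 0" by auto
  then have \<beta>: "\<beta> \<in> K" "\<beta> \<noteq> 0"
    unfolding \<beta>_def using an[OF f2(1)] f2(1) N by (auto intro: qform_K)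
  have f3: "f3 \<in> vecs q 1" "f3 $ 3 = 1"
  proof -
    show "f3 \<in> vecs q 1"
      unfolding f3_def using N e1 f2 \<alpha> \<beta> K2 by (intro vecs_1_closed K_closed polar_K)
    show "f3 $ 3 = 1"
      using f2 by (simp add: f3_def e1_def axis_def)
  qed
  then have \<gamma>: "\<gamma> \<in> K"
    unfolding \<gamma>_def using N by (auto intro: qform_K)
  have diff: "polar_form N v (u - c *s w) = polar_form N v u - c * polar_form N v w" for u v w c
    using polar_linear(2)[of N v "u - c *s w" "c *s w"] by (simp add: polar_linear(4))
  have "polar_form N e1 e1 = 2 * \<alpha>" "polar_form N f2 f2 = 2 * \<beta>"
    by (simp_all add: polar_self \<alpha>_def \<beta>_def)
  then have 12: "polar_form N e1 f2 = 0"
    using \<alpha> two by (simp add: f2_def diff)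
  then have 21: "polar_form N f2 e1 = 0"
    by (simp add: polar_commute)
  have 13: "polar_form N e1 f3 = 0"
    using \<open>polar_form N e1 e1 = 2 * \<alpha>\<close> 12 \<alpha> two by (simp add: f3_def diff)
  have 23: "polar_form N f2 f3 = 0"
    using \<open>polar_form N f2 f2 = 2 * \<beta>\<close> 21 \<beta> two by (simp add: f3_def diff)
  obtain x y where xy: "x \<in> K" "y \<in> K" "\<alpha> * x\<^sup>2 + \<beta> * y\<^sup>2 + \<gamma> = 0"
    using diagonal_ternary_isotropic[OF \<alpha>(1) \<beta>(1) \<gamma> \<alpha>(2) \<beta>(2)] .
  have "qform N (x *s e1 + y *s f2 + 1 *s f3) = 0"
    unfolding qform_comb3 using xy by (simp add: 12 13 23 flip: \<alpha>_def \<beta>_def \<gamma>_def)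
       (simp add: mult.commute)
  moreover have "(x *s e1 + y *s f2 + 1 *s f3) $ 3 = 1"
    using f2 f3 by (simp add: e1_def axis_def)
  then have "x *s e1 + y *s f2 + 1 *s f3 \<noteq> 0" by (metis zero_index zero_neq_one)
  moreover have "x *s e1 + y *s f2 + 1 *s f3 \<in> vecs q 1"
    using xy e1 f2 f3 by (intro vecs_1_closed) auto
  ultimately show False using an by blast
qed

text \<open>A rational point p is completed to a hyperbolic pair p, w, and v spans the orthogonal
  complement of the pair. If Q(v) were 0, then v would be orthogonal to p, v and w, hence a singular
  point. No square is completed, so characteristic 2 is covered.\<close>

lemma conic_normal_form:
  fixes N :: "'a ^ 3 ^ 3"
  assumes N: "N \<in> mats q 1" and nd: "nondegenerate_on UNIV N"
  obtains p v w c where "p \<in> vecs q 1" "v \<in> vecs q 1" "w \<in> vecs q 1" "c \<in> K" "c \<noteq> 0"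
    "\<And>x y z. qform N (x *s p + y *s v + z *s w) = x * z + c * y\<^sup>2"
    "\<And>u. \<exists>x y z. u = x *s p + y *s v + z *s w"
proof -
  obtain p where p: "p \<in> vecs q 1" "p \<noteq> 0" "qform N p = 0"
    using char_2_isotropic[OF N] odd_char_isotropic[OF N] by blast
  obtain w0 where w0: "polar_form N p w0 \<noteq> 0"
    using nd p by (auto simp: nondegenerate_on_def)
  have lin: "polar_form N u (\<Sum>i\<in>UNIV. x i *s b i) = (\<Sum>i\<in>UNIV. x i * polar_form N u (b i))"
    for u x and b :: "3 \<Rightarrow> 'a ^ 3"
    by (simp add: sum_3 polar_linear)
  \<comment> \<open>Nondegeneracy yields only a vector \<open>w0\<close> over the largest field. By
    linearity some unit vector, which is rational, also lies off the tangent line at p.\<close>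
  have "\<exists>i. polar_form N p (axis i 1) \<noteq> 0"
  proof (rule ccontr)
    assume "\<not> ?thesis"
    then have "polar_form N p (\<Sum>i\<in>UNIV. w0 $ i *s axis i 1) = 0"
      by (simp add: lin)
    then show False using w0 by (simp add: basis_expansion)
  qed
  then obtain i where i: "polar_form N p (axis i 1) \<noteq> 0" by blast
  define w1 :: "'a ^ 3" where "w1 = (1 / polar_form N p (axis i 1)) *s axis i 1"
  have w1: "w1 \<in> vecs q 1" "polar_form N p w1 = 1"
    unfolding w1_def using i p N by (auto intro!: vecs_1_closed K_closed polar_K simp: polar_linear)
  \<comment> \<open>Since p is a zero and pairs to 1 with \<open>w1\<close>, adding t p changes the
    value of the form by t; so t is minus that value.\<close>
  define w where "w = w1 + (- qform N w1) *s p"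
  have pp: "polar_form N p p = 0" using p(3) by (simp add: polar_self)
  have w: "w \<in> vecs q 1" "polar_form N p w = 1" "qform N w = 0"
  proof -
    show "w \<in> vecs q 1"
      unfolding w_def using w1 p N by (intro vecs_1_closed K_closed qform_K)
    show "polar_form N p w = 1"
      unfolding w_def polar_linear using w1 pp by simp
    show "qform N w = 0"
      unfolding w_def qform_add qform_scale polar_linear using w1 p polar_commute[of N w1 p] by simp
  qed
  have ww: "polar_form N w w = 0" using w(3) by (simp add: polar_self)
  obtain j where j: "axis j 1 \<notin> vec.span {p, w}"
    using axis_notin_span_pair by blast
  \<comment> \<open>Removing the components along the hyperbolic pair makes v orthogonal to p and w
    without moving it into their span.\<close>
  define v where "v = axis j 1 + (- polar_form N w (axis j 1)) *s p + (- polar_form N p (axis j 1)) *s w"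
  have v: "v \<in> vecs q 1"
    unfolding v_def using p w N by (intro vecs_1_closed K_closed polar_K) auto
  have pv: "polar_form N p v = 0" "polar_form N v w = 0"
    unfolding v_def polar_linear
    using pp ww w(2) polar_commute[of N "axis j 1" w] by simp_all
  have v_out: "v \<notin> vec.span {p, w}"
  proof
    assume "v \<in> vec.span {p, w}"
    moreover have "p \<in> vec.span {p, w}" "w \<in> vec.span {p, w}"
      by (auto intro: vec.span_base)
    ultimately have "v - (- polar_form N w (axis j 1)) *s p - (- polar_form N p (axis j 1)) *s w \<in> vec.span {p, w}"
      by (intro vec.span_diff vec.span_scale)
    then show False using j by (simp add: v_def)
  qed
  define c where "c = qform N v"
  have form: "qform N (x *s p + y *s v + z *s w) = x * z + c * y\<^sup>2" for x y z
    by (simp add: qform_comb3 p(3) w pv c_def)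
  have indep: "x = 0 \<and> y = 0 \<and> z = 0" if "x *s p + y *s v + z *s w = 0" for x y z
  proof -
    have "polar_form N p (x *s p + y *s v + z *s w) = z" "polar_form N w (x *s p + y *s v + z *s w) = x"
      by (simp_all add: polar_linear pp ww pv w(2) polar_commute[of N w p] polar_commute[of N w v])
    moreover have "polar_form N u 0 = 0" for u using polar_linear(4)[of N u 0 0] by simp
    ultimately have "z = 0" "x = 0" using that by auto
    moreover have "v \<noteq> 0" using v_out vec.span_zero by metis
    ultimately show ?thesis using that by simp
  qed
  \<comment> \<open>Independence makes this map of triples injective. Source and target have equal
    finite cardinality, so p, v, w also span.\<close>
  define T where "T = (\<lambda>(x, y, z). x *s p + y *s v + z *s w)"
  have "inj T"
  proof (rule injI)
    fix a b assume "T a = T b"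
    moreover obtain x y z where a: "a = (x, y, z)" by (cases a)
    moreover obtain x' y' z' where b: "b = (x', y', z')" by (cases b)
    ultimately have "(x - x') *s p + (y - y') *s v + (z - z') *s w = 0"
      by (simp add: T_def vector_sub_rdistrib algebra_simps)
    from indep[OF this] show "a = b" by (simp add: a b)
  qed
  then have "card (range T) = CARD('a ^ 3)"
    by (simp add: card_image card_prod power3_eq_cube flip: UNIV_Times_UNIV)
  then have "range T = UNIV"
    by (intro card_subset_eq) auto
  then have span: "\<exists>x y z. u = x *s p + y *s v + z *s w" for u
    using surjD[of T u] by (auto simp: T_def)
  have "c \<noteq> 0"
  proof
    assume "c = 0"
    moreover have "v \<noteq> 0" using v_out vec.span_zero by metis
    ultimately obtain u where u: "polar_form N v u \<noteq> 0"
      using nd by (auto simp: nondegenerate_on_def c_def)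
    obtain x y z where "u = x *s p + y *s v + z *s w" using span by blast
    then have "polar_form N v u = 0"
      using \<open>c = 0\<close> by (simp add: polar_linear polar_commute[of N v p] pv polar_self flip: c_def)
    then show False using u by blast
  qed
  moreover have "c \<in> K" using N v by (simp add: c_def qform_K)
  ultimately show ?thesis using that[OF p(1) v w(1) _ _ form span] by blast
qed

text \<open>Along the parametrisation \<open>s \<mapsto> (- c s\<^sup>2, s, 1)\<close> of the conic, the second form is a quartic
  polynomial with at least \<open>q\<close> roots.\<close>
lemma conic_determined_by_rational_points:
  fixes N N' :: "'a ^ 3 ^ 3"
  assumes N: "N \<in> mats q 1" and nd: "nondegenerate_on UNIV N" and nd': "nondegenerate_on UNIV N'"
    and sub: "\<And>v. v \<in> vecs q 1 \<Longrightarrow> qform N v = 0 \<Longrightarrow> qform N' v = 0" and q: "q \<ge> 5"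
  shows "qform N' u = 0 \<longleftrightarrow> qform N u = 0"
proof -
  obtain p v w c where pvw: "p \<in> vecs q 1" "v \<in> vecs q 1" "w \<in> vecs q 1" and c: "c \<in> K" "c \<noteq> 0"
    and form: "\<And>x y z. qform N (x *s p + y *s v + z *s w) = x * z + c * y\<^sup>2"
    and span: "\<And>u. \<exists>x y z. u = x *s p + y *s v + z *s w"
    using conic_normal_form[OF N nd] by blast
  define A B E F G H where "A = qform N' p" and "B = qform N' v" and "E = qform N' w"
    and "F = polar_form N' p v" and "G = polar_form N' p w" and "H = polar_form N' v w"
  note defs = \<open>A = _\<close> \<open>B = _\<close> \<open>E = _\<close> \<open>F = _\<close> \<open>G = _\<close> \<open>H = _\<close>
  \<comment> \<open>The coefficients of N' in the new basis, sorted by powers of s after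
    substitution. The parameter s reaches every rational point of the conic except p, whence q roots
    rather than q + 1.\<close>
  define R where "R = [: E, H, B - G * c, - (c * F), A * c\<^sup>2 :]"
  have R0: "poly R s = 0" if s: "s \<in> K" for s
  proof -
    have "qform N' ((- c * s\<^sup>2) *s p + s *s v + 1 *s w) = 0"
    proof (rule sub)
      show "(- c * s\<^sup>2) *s p + s *s v + 1 *s w \<in> vecs q 1"
        using c s pvw by (intro vecs_1_closed K_closed K_power) auto
      show "qform N ((- c * s\<^sup>2) *s p + s *s v + 1 *s w) = 0"
        unfolding form by simp
    qed
    then show ?thesis
      unfolding qform_comb3 R_def defs[symmetric] by (simp add: power2_eq_square algebra_simps)
  qed
  have "R = 0"
  proof (rule ccontr)
    assume "R \<noteq> 0"
    then have "card {s. poly R s = 0} \<le> degree R" by (rule card_poly_roots_bound)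
    also have "\<dots> \<le> 4" by (simp add: R_def)
    finally have "card {s. poly R s = 0} \<le> 4" .
    moreover have "card K \<le> card {s. poly R s = 0}"
      by (rule card_mono) (auto simp: R0)
    ultimately show False using card_K_ge q by simp
  qed
  then have z: "E = 0" "H = 0" "B = G * c" "F = 0" "A = 0"
    using c by (simp_all add: R_def)
  have form': "qform N' (x *s p + y *s v + z *s w) = G * (x * z + c * y\<^sup>2)" for x y z
    unfolding qform_comb3 defs[symmetric] using z by (simp add: algebra_simps)
  have proportional: "qform N' u = G * qform N u" for u
    using span[of u] form form' by auto
  have "G \<noteq> 0"
  proof
    assume "G = 0"
    then have zero: "qform N' u = 0" for u by (simp add: proportional)
    have "axis 1 1 \<noteq> (0 :: 'a ^ 3)" by simp
    then obtain u where "polar_form N' (axis 1 1) u \<noteq> 0"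
      using nd' zero unfolding nondegenerate_on_def by blast
    then show False by (simp add: polar_form_def zero)
  qed
  then show ?thesis by (simp add: proportional)
qed

end

section \<open>Coordinates\<close>

lemma invertible_bij:
  assumes "invertible (A :: 'a::field ^ 'n ^ 'n)"
  shows "bij ((*v) A)"
proof -
  obtain A' where A': "A ** A' = mat 1" "A' ** A = mat 1"
    using assms unfolding invertible_def by blast
  show ?thesis
    by (rule o_bij[of "(*v) A'"]) (simp_all add: fun_eq_iff matrix_vector_mul_assoc A')
qed

context frobenius_field
begin

text \<open>Read as commutation with the Frobenius map, rationality of matrices is visibly closed
  under products, and it can be checked on the linear map that a matrix represents.\<close>

lemma mats_iff_frob:
  fixes M :: "'a ^ 'n ^ 'm"
  shows "M \<in> mats q k \<longleftrightarrow> (\<forall>x. (frob q ^^ k) (M *v x) = M *v ((frob q ^^ k) x))"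
proof
  assume *: "\<forall>x. (frob q ^^ k) (M *v x) = M *v ((frob q ^^ k) x)"
  have "(M $ i $ j) ^ (q ^ k) = M $ i $ j" for i j
  proof -
    have ax: "(frob q ^^ k) (axis j 1 :: 'a ^ 'n) = axis j 1"
      by (induction k) simp_all
    have "((frob q ^^ k) (M *v axis j 1)) $ i = (M *v axis j 1) $ i"
      using * ax by simp
    then show ?thesis
      by (simp add: frob_iter_nth matrix_vector_mult_def axis_def if_distrib cong: if_cong)
  qed
  then show "M \<in> mats q k" by (simp add: mats_def)
qed (simp add: frob_iter_mats)

lemma mats_mult:
  fixes M :: "'a ^ 'n ^ 'm"
  assumes "M \<in> mats q k" "M' \<in> mats q k"
  shows "M ** M' \<in> mats q k"
  using assms by (simp add: mats_iff_frob flip: matrix_vector_mul_assoc)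

lemma mats_1_subset: "(M :: 'a ^ 'n ^ 'm) \<in> mats q 1 \<Longrightarrow> M \<in> mats q k"
proof -
  have "x ^ (q ^ k) = x" if "x ^ q = x" for x :: 'a
    using that by (induction k) (simp_all add: power_mult)
  then show "M \<in> mats q 1 \<Longrightarrow> M \<in> mats q k" by (simp add: mats_def)
qed

lemma transpose_mats: "(M :: 'a ^ 'n ^ 'm) \<in> mats q k \<Longrightarrow> transpose M \<in> mats q k"
  by (simp add: mats_def transpose_def)

text \<open>Two points of the subplane on L have rational coordinate vectors. Taking them as the
  first two basis vectors, with a rational third one, is a base change over \<open>K\<close>: it
  preserves the subplane and the rationality of the conic while moving L to the line where the third
  coordinate vanishes.\<close>

lemma fq_conic_coordinates:
  fixes L :: "('a ^ 3) set"
  assumes conic: "fq_conic_in q B C" and L: "line_over q 3 L" and cardBL: "card (B \<inter> pts q 3 L) \<ge> 2"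
  obtains A N :: "'a ^ 3 ^ 3" where "A \<in> mats q 3" "bij ((*v) A)" "N \<in> mats q 1" "nondegenerate_on UNIV N"
    "B = {vec.span {A *v x} | x. x \<in> vecs q 1 \<and> x \<noteq> 0}"
    "C = {vec.span {A *v x} | x. x \<in> vecs q 1 \<and> x \<noteq> 0 \<and> qform N x = 0}"
    "L = (*v) A ` {x. x $ 3 = 0}"
proof -
  obtain A0 C0 where A0: "A0 \<in> mats q 3" "invertible A0" and B: "B = (\<lambda>X. (*v) A0 ` X) ` PG q 1"
    and C0: "nd_conic q 1 C0" and C: "C = (\<lambda>X. (*v) A0 ` X) ` C0"
    using conic unfolding fq_conic_in_def by blast
  obtain N0 where N0: "N0 \<in> mats q 1" "nondegenerate_on UNIV N0" "C0 = conic_pts q 1 UNIV N0"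
    using C0 unfolding nd_conic_def by blast
  have bij0: "bij ((*v) A0)" using A0(2) by (rule invertible_bij)
  have im: "(*v) A0 ` vec.span {x} = vec.span {A0 *v x}" for x
    by (rule image_span_1) simp
  have "\<not> card (B \<inter> pts q 3 L) \<le> Suc 0" using cardBL by simp
  then obtain X Y where XY: "X \<in> B \<inter> pts q 3 L" "Y \<in> B \<inter> pts q 3 L" "X \<noteq> Y"
    using card_le_Suc0_iff_eq[of "B \<inter> pts q 3 L"] by (metis finite)
  obtain e1 where e1: "e1 \<in> vecs q 1" "e1 \<noteq> 0" "X = vec.span {A0 *v e1}"
    using XY(1) unfolding B PG_def by (auto simp: im)
  obtain e2 where e2: "e2 \<in> vecs q 1" "e2 \<noteq> 0" "Y = vec.span {A0 *v e2}"
    using XY(2) unfolding B PG_def by (auto simp: im)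
  have subL: "vec.subspace L" and dimL: "vec.dim L = 2"
    using L unfolding line_over_def subspace_over_def by auto
  have eL: "A0 *v e1 \<in> L" "A0 *v e2 \<in> L"
    using XY e1 e2 unfolding pts_def by (auto intro: vec.span_base)
  have e12: "e1 \<notin> vec.span {e2}"
  proof
    assume "e1 \<in> vec.span {e2}"
    then have "vec.span {e1} = vec.span {e2}" using e1 e2 by (simp add: span_1_eq_iff)
    then show False using XY(3) e1(3) e2(3) by (simp flip: im)
  qed
  obtain j where j: "axis j 1 \<notin> vec.span {e1, e2}"
    using axis_notin_span_pair by blast
  define e3 :: "'a ^ 3" where "e3 = axis j 1"
  have e3: "e3 \<in> vecs q 1" by (simp add: e3_def vecs_1_closed)
  define T :: "'a ^ 3 ^ 3" where
    "T = (\<chi> i j. if j = 1 then e1 $ i else if j = 2 then e2 $ i else e3 $ i)"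
  have Tv: "T *v x = x $ 1 *s e1 + x $ 2 *s e2 + x $ 3 *s e3" for x
    by (simp add: T_def matrix_vector_mult_def vec_eq_iff sum_3 mult.commute)
  have T1: "T \<in> mats q 1"
    using e1 e2 e3 by (auto simp: T_def mats_1_iff in_vecs_1_iff_K)
  have ker: "x = 0" if "T *v x = 0" for x
  proof -
    have z: "x $ 1 *s e1 + x $ 2 *s e2 + x $ 3 *s e3 = 0" using that by (simp add: Tv)
    have in12: "e1 \<in> vec.span {e1, e2}" "e2 \<in> vec.span {e1, e2}" by (auto intro: vec.span_base)
    have x3: "x $ 3 = 0"
    proof (rule ccontr)
      assume n: "x $ 3 \<noteq> 0"
      have "x $ 3 *s e3 = - (x $ 1 *s e1 + x $ 2 *s e2)"
        using z by (metis add.commute eq_neg_iff_add_eq_0)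
      then have "inverse (x $ 3) *s (x $ 3 *s e3) = inverse (x $ 3) *s - (x $ 1 *s e1 + x $ 2 *s e2)"
        by simp
      then have "e3 = inverse (x $ 3) *s - (x $ 1 *s e1 + x $ 2 *s e2)"
        using n by simp
      also have "\<dots> \<in> vec.span {e1, e2}"
        using in12 by (intro vec.span_scale vec.span_neg vec.span_add)
      finally show False using j by (simp add: e3_def)
    qed
    have x1: "x $ 1 = 0"
    proof (rule ccontr)
      assume n: "x $ 1 \<noteq> 0"
      have "x $ 1 *s e1 = - (x $ 2 *s e2)"
        using z x3 by (simp add: eq_neg_iff_add_eq_0)
      then have "inverse (x $ 1) *s (x $ 1 *s e1) = inverse (x $ 1) *s - (x $ 2 *s e2)"
        by simp
      then have "e1 = inverse (x $ 1) *s - (x $ 2 *s e2)"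
        using n by simp
      also have "\<dots> \<in> vec.span {e2}"
        by (intro vec.span_scale vec.span_neg vec.span_base) simp
      finally show False using e12 by simp
    qed
    have "x $ 2 = 0" using z x1 x3 e2(2) by simp
    then show "x = 0" using x1 x3 by (simp add: vec_eq_iff forall_3)
  qed
  have "inj ((*v) T)"
  proof (rule injI)
    fix x y assume "T *v x = T *v y"
    then have "T *v (x - y) = 0" by (simp add: matrix_vector_mult_diff_distrib)
    from ker[OF this] show "x = y" by simp
  qed
  then have bijT: "bij ((*v) T)"
    using finite_UNIV_inj_surj[OF finite] by (simp add: bij_def)
  have vecsT: "T *v x \<in> vecs q 1 \<longleftrightarrow> x \<in> vecs q 1" for x
    using frob_iter_mats[OF T1, of x] injD[OF bij_is_inj[OF bijT]]
    by (auto simp: in_vecs_iff)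
  have img: "(\<lambda>X. (*v) A0 ` X) ` {vec.span {v} | v. P v} = {vec.span {A0 *v v} | v. P v}" for P
    by (force simp flip: im)
  define A where "A = A0 ** T"
  have Av: "A *v x = A0 *v (T *v x)" for x
    by (simp add: A_def matrix_vector_mul_assoc)
  \<comment> \<open>T permutes the nonzero rational vectors, so the base change only renames the
    points of B and of C.\<close>
  have reparam: "{vec.span {A *v x} | x. x \<in> vecs q 1 \<and> x \<noteq> 0 \<and> P (T *v x)} =
      {vec.span {A0 *v x} | x. x \<in> vecs q 1 \<and> x \<noteq> 0 \<and> P x}" for P
  proof safe
    fix x assume x: "x \<in> vecs q 1" "x \<noteq> 0" "P (T *v x)"
    have "T *v x \<noteq> 0"
      using x(2) injD[OF bij_is_inj[OF bijT], of x 0] by auto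
    then show "\<exists>y. vec.span {A *v x} = vec.span {A0 *v y} \<and> y \<in> vecs q 1 \<and> y \<noteq> 0 \<and> P y"
      using x by (intro exI[of _ "T *v x"]) (simp add: Av vecsT)
  next
    fix x assume x: "x \<in> vecs q 1" "x \<noteq> 0" "P x"
    obtain y where y: "x = T *v y" using surjD[OF bij_is_surj[OF bijT]] by blast
    then show "\<exists>y. vec.span {A0 *v x} = vec.span {A *v y} \<and> y \<in> vecs q 1 \<and> y \<noteq> 0 \<and> P (T *v y)"
      using x by (intro exI[of _ y]) (auto simp: Av vecsT)
  qed
  show ?thesis
  proof (rule that[of A "transpose T ** N0 ** T"])
    show "A \<in> mats q 3"
      unfolding A_def using A0(1) mats_1_subset[OF T1] by (rule mats_mult)
    show bijA: "bij ((*v) A)"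
    proof -
      have "(*v) A = (*v) A0 \<circ> (*v) T" by (auto simp: Av)
      then show ?thesis using bij_comp[OF bijT bij0] by simp
    qed
    show "transpose T ** N0 ** T \<in> mats q 1"
      using T1 N0 by (intro mats_mult transpose_mats)
    show "nondegenerate_on UNIV (transpose T ** N0 ** T)"
      using N0(2) bijT by (rule nondegenerate_on_congruence)
    show "B = {vec.span {A *v x} | x. x \<in> vecs q 1 \<and> x \<noteq> 0}"
      using reparam[of "\<lambda>_. True"] unfolding B PG_def img by simp
    show "C = {vec.span {A *v x} | x. x \<in> vecs q 1 \<and> x \<noteq> 0 \<and> qform (transpose T ** N0 ** T) x = 0}"
    proof -
      have "C0 = {vec.span {v} | v. v \<in> vecs q 1 \<and> v \<noteq> 0 \<and> qform N0 v = 0}"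
        unfolding N0(3) conic_pts_def pts_def PG_def by (auto simp: vanishes_at_span_1)
      then show ?thesis
        unfolding C qform_congruence reparam[of "\<lambda>x. qform N0 x = 0"] by (simp only: img)
    qed
    show "L = (*v) A ` {x. x $ 3 = 0}"
    proof -
      let ?S = "(*v) A ` {x. x $ 3 = 0}"
      have lin: "Vector_Spaces.linear (*s) (*s) ((*v) A)" by simp
      have sub: "?S \<subseteq> L"
        using subL eL by (auto simp: Av Tv matrix_vector_right_distrib vec.scale
            intro!: vec.subspace_add vec.subspace_scale)
      have eq: "{x :: 'a ^ 3. x $ 3 = 0} = {x. \<forall>i. i \<notin> {1, 2} \<longrightarrow> x $ i = 0}"
        by (auto simp: forall_3)
      have "vec.dim {x :: 'a ^ 3. x $ 3 = 0} = 2"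
        unfolding eq dim_substandard_cart by simp
      moreover have "vec.dim ?S = vec.dim {x :: 'a ^ 3. x $ 3 = 0}"
        using lin bijA by (intro vec.dim_image_eq) (auto simp: bij_def inj_on_def)
      moreover have "vec.subspace ?S"
        using lin by (intro vec.linear_subspace_image) (auto simp: vec.subspace_def)
      ultimately show ?thesis
        using vec.subspace_dim_equal[of ?S L] sub subL dimL by simp
    qed
  qed
qed

end

section \<open>Block coordinates on the nine-dimensional space\<close>

locale bose_coordinates = frobenius_field q K
  for q :: nat and K :: "'a::{field,finite} set" +
  fixes f0 :: "'a ^ 3 \<Rightarrow> 'a ^ 9"
  assumes f0_linear: "Vector_Spaces.linear (*s) (*s) f0"
    and frob_3_f0: "frob q (frob q (frob q (f0 x))) = f0 (frob q (frob q (frob q x)))"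
    and f0_span: "vec.span (range f0 \<union> frob q ` range f0 \<union> frob q ` frob q ` range f0) = UNIV"
begin

text \<open>The fifth power of the Frobenius map is its inverse, and the fourth power, used for
  \<open>f2\<close>, is the inverse of its square. Conjugating in this way keeps the
  parametrisations of the conjugate planes linear, and it uses exactly the exponents of the
  scroll-planes.\<close>

definition f1 :: "'a ^ 3 \<Rightarrow> 'a ^ 9" where
  "f1 x = frob q (f0 ((frob q ^^ 5) x))"

definition f2 :: "'a ^ 3 \<Rightarrow> 'a ^ 9" where
  "f2 x = frob q (frob q (f0 ((frob q ^^ 4) x)))"

lemma funpow_simps:
  "(frob q ^^ 3) x = frob q (frob q (frob q x))"
  "(frob q ^^ 4) x = frob q (frob q (frob q (frob q x)))"
  "(frob q ^^ 5) x = frob q (frob q (frob q (frob q (frob q x))))"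
  for x :: "'a ^ 'n"
  by (simp_all add: numeral_eq_Suc One_nat_def)

lemma frob_f0: "frob q (f0 x) = f1 (frob q x)"
  by (simp add: f1_def funpow_simps frob_6)

lemma frob_f1: "frob q (f1 x) = f2 (frob q x)"
  by (simp add: f1_def f2_def funpow_simps frob_6)

text \<open>This closes the cycle of the three planes. Here it enters, through
  \<open>frob_3_f0\<close>, that Gamma is defined over the subfield of order q^3.\<close>

lemma frob_f2: "frob q (f2 x) = f0 (frob q x)"
  by (simp add: f2_def funpow_simps frob_6 frob_3_f0)

lemmas f0_simps = vec.linear_add[OF f0_linear] vec.linear_scale[OF f0_linear] vec.linear_0[OF f0_linear]

lemma power_q6' [simp]: "((((((x::'a) ^ q) ^ q) ^ q) ^ q) ^ q) ^ q = x"
proof -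
  have "((((((x::'a) ^ q) ^ q) ^ q) ^ q) ^ q) ^ q = x ^ (q ^ 6)"
    by (simp add: numeral_eq_Suc One_nat_def power_mult)
  then show ?thesis by simp
qed

lemma linearI:
  fixes g :: "'a ^ 'n \<Rightarrow> 'a ^ 'm"
  assumes "\<And>x y. g (x + y) = g x + g y" "\<And>c x. g (c *s x) = c *s g x"
  shows "Vector_Spaces.linear (*s) (*s) g"
  using assms by (intro Vector_Spaces.linear_iff[THEN iffD2])
    (simp add: vec.vector_space_axioms)

lemma f1_linear: "Vector_Spaces.linear (*s) (*s) f1"
  by (rule linearI) (simp_all add: f1_def f0_simps frob_add frob_scale funpow_simps)

lemma f2_linear: "Vector_Spaces.linear (*s) (*s) f2"
  by (rule linearI) (simp_all add: f2_def f0_simps frob_add frob_scale funpow_simps)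

lemmas f_simps = f0_simps
  vec.linear_add[OF f1_linear] vec.linear_scale[OF f1_linear] vec.linear_0[OF f1_linear]
  vec.linear_add[OF f2_linear] vec.linear_scale[OF f2_linear] vec.linear_0[OF f2_linear]

definition \<Theta> :: "'a ^ 3 \<Rightarrow> 'a ^ 3 \<Rightarrow> 'a ^ 3 \<Rightarrow> 'a ^ 9" where
  "\<Theta> x y z = f0 x + f1 y + f2 z"

lemma \<Theta>_add: "\<Theta> x y z + \<Theta> x' y' z' = \<Theta> (x + x') (y + y') (z + z')"
  by (simp add: \<Theta>_def f_simps)

lemma \<Theta>_scale: "c *s \<Theta> x y z = \<Theta> (c *s x) (c *s y) (c *s z)"
  by (simp add: \<Theta>_def f_simps vec.scale_right_distrib)

lemma \<Theta>_0 [simp]: "\<Theta> 0 0 0 = 0"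
  by (simp add: \<Theta>_def f_simps)

lemma frob_\<Theta>: "frob q (\<Theta> x y z) = \<Theta> (frob q z) (frob q x) (frob q y)"
  by (simp add: \<Theta>_def frob_add frob_f0 frob_f1 frob_f2)

lemma subspace_\<Theta>:
  assumes "P 0 0 0"
    and "\<And>x y z x' y' z'. P x y z \<Longrightarrow> P x' y' z' \<Longrightarrow> P (x + x') (y + y') (z + z')"
    and "\<And>c x y z. P x y z \<Longrightarrow> P (c *s x) (c *s y) (c *s z)"
  shows "vec.subspace {\<Theta> x y z | x y z. P x y z}"
proof (rule vec.subspaceI)
  show "0 \<in> {\<Theta> x y z | x y z. P x y z}"
    using assms(1) \<Theta>_0 by (metis (mono_tags, lifting) mem_Collect_eq)
qed (use assms(2,3) in \<open>auto simp: \<Theta>_add \<Theta>_scale, blast+\<close>)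

lemma \<Theta>_surj: "\<exists>x y z. v = \<Theta> x y z"
proof -
  let ?S = "{\<Theta> x y z | x y z. True}"
  have "vec.subspace ?S" by (rule subspace_\<Theta>) auto
  moreover have "range f0 \<union> frob q ` range f0 \<union> frob q ` frob q ` range f0 \<subseteq> ?S"
  proof -
    have "f0 x \<in> ?S" "f1 x \<in> ?S" "f2 x \<in> ?S" for x
      using \<Theta>_def[of x 0 0] \<Theta>_def[of 0 x 0] \<Theta>_def[of 0 0 x] by (auto simp: f_simps, metis+)
    then show ?thesis by (auto simp: frob_f0 frob_f1)
  qed
  ultimately have "vec.span (range f0 \<union> frob q ` range f0 \<union> frob q ` frob q ` range f0) \<subseteq> ?S"
    by (intro vec.span_minimal)
  then have "v \<in> ?S" using f0_span by blast
  then show ?thesis by blast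
qed

text \<open>Three blocks of length 3 are as many vectors as there are in dimension 9, so
  surjectivity already gives injectivity: the plane and its conjugates are independent.\<close>

lemma \<Theta>_eq_iff [simp]: "\<Theta> x y z = \<Theta> x' y' z' \<longleftrightarrow> x = x' \<and> y = y' \<and> z = z'"
proof -
  let ?T = "\<lambda>(x, y, z). \<Theta> x y z"
  have "surj ?T" using \<Theta>_surj by (force simp: surj_def)
  then have "card (range ?T) = CARD(('a ^ 3) \<times> ('a ^ 3) \<times> ('a ^ 3))"
    by (simp add: card_prod flip: power_add)
  then have "inj ?T"
    by (intro eq_card_imp_inj_on) auto
  then show ?thesis by (auto dest: injD[of ?T "(x, y, z)" "(x', y', z')"])
qed

lemma \<Theta>_eq_0_iff [simp]: "\<Theta> x y z = 0 \<longleftrightarrow> x = 0 \<and> y = 0 \<and> z = 0"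
  using \<Theta>_eq_iff[of x y z 0 0 0] by (simp del: \<Theta>_eq_iff)

definition scroll :: "'a ^ 3 \<Rightarrow> ('a ^ 9) set" where
  "scroll x = {\<Theta> (a *s x) (b *s x) (c *s x) | a b c. True}"

lemma span_Un_3:
  "vec.span (vec.span {u} \<union> vec.span {v} \<union> vec.span {w}) = {a *s u + b *s v + c *s w | a b c. True}"
  for u v w :: "'a ^ 'n"
  unfolding vec.span_Un vec.span_span unfolding span_1 by (auto simp: image_iff) blast

lemma scroll_eq_span:
  "scroll x = vec.span (f0 ` vec.span {x} \<union> frob q ` f0 ` vec.span {(frob q ^^ 5) x}
     \<union> frob q ` frob q ` f0 ` vec.span {(frob q ^^ 4) x})"
  by (simp only: image_span_1[OF f0_linear] frob_image_span_1 span_Un_3 flip: f1_def f2_def)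
    (simp add: scroll_def \<Theta>_def f_simps)

lemma frob_span_point:
  "frob_span q (f0 ` vec.span {x}) =
     {\<Theta> (a *s x) (b *s frob q x) (c *s frob q (frob q x)) | a b c. True}"
  unfolding frob_span_def
  by (simp only: image_span_1[OF f0_linear] frob_image_span_1 span_Un_3 frob_f0 frob_f1)
    (simp add: \<Theta>_def f_simps)

text \<open>The plane of a point has block vectors proportional to x, x^q and x^(q^2), which agree
  when x is rational. Hence spread planes appear at infinity when the conic has rational points
  there.\<close>

lemma frob_span_rational_point: "frob q x = x \<Longrightarrow> frob_span q (f0 ` vec.span {x}) = scroll x"
  by (simp add: frob_span_point scroll_def)

definition infinity :: "('a ^ 9) set" where
  "infinity = {\<Theta> x y z | x y z. x $ 3 = 0 \<and> y $ 3 = 0 \<and> z $ 3 = 0}"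

lemma \<Theta>_in_infinity [simp]: "\<Theta> x y z \<in> infinity \<longleftrightarrow> x $ 3 = 0 \<and> y $ 3 = 0 \<and> z $ 3 = 0"
  by (auto simp: infinity_def)

lemma subspace_infinity: "vec.subspace infinity"
  unfolding infinity_def by (rule subspace_\<Theta>) auto

lemma frob_span_line: "frob_span q (f0 ` {x. x $ 3 = 0}) = infinity"
proof
  have *: "f0 x = \<Theta> x 0 0" "f1 x = \<Theta> 0 x 0" "f2 x = \<Theta> 0 0 x" for x
    by (simp_all add: \<Theta>_def f_simps)
  show "frob_span q (f0 ` {x. x $ 3 = 0}) \<subseteq> infinity"
    unfolding frob_span_def
    by (intro vec.span_minimal subspace_infinity) (auto simp: frob_f0 frob_f1, auto simp: *)
  \<comment> \<open>The fifth power of the Frobenius map supplies preimages and keeps the third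
    coordinate 0.\<close>
  have fr: "\<exists>y. x = frob q y \<and> y $ 3 = 0" if "x $ 3 = 0" for x :: "'a ^ 3"
    using that by (intro exI[of _ "(frob q ^^ 5) x"]) (simp add: funpow_simps frob_6)
  show "infinity \<subseteq> frob_span q (f0 ` {x. x $ 3 = 0})"
  proof
    fix v assume "v \<in> infinity"
    then obtain x y z where v: "v = f0 x + f1 y + f2 z" and x: "x $ 3 = 0" "y $ 3 = 0" "z $ 3 = 0"
      by (auto simp: infinity_def \<Theta>_def)
    obtain y' where y': "y = frob q y'" "y' $ 3 = 0" using fr x(2) by blast
    obtain z' where z': "z = frob q z'" "z' $ 3 = 0" using fr x(3) by blast
    obtain z'' where z'': "z' = frob q z''" "z'' $ 3 = 0" using fr z'(2) by blast
    have "f1 y = frob q (f0 y')" "f2 z = frob q (frob q (f0 z''))"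
      by (simp_all add: y' z' z'' frob_f0 frob_f1)
    then show "v \<in> frob_span q (f0 ` {x. x $ 3 = 0})"
      unfolding frob_span_def v using x y' z''
      by (intro vec.span_add; intro vec.span_base) auto
  qed
qed

text \<open>Both bounds come from spanning sets: six vectors span this space, and three further ones
  enlarge it to dimension 9. Independence is never checked.\<close>

lemma dim_infinity: "vec.dim infinity = 6"
proof -
  define I :: "('a ^ 9) set" where
    "I = {\<Theta> (axis 1 1) 0 0, \<Theta> (axis 2 1) 0 0, \<Theta> 0 (axis 1 1) 0, \<Theta> 0 (axis 2 1) 0,
      \<Theta> 0 0 (axis 1 1), \<Theta> 0 0 (axis 2 1)}"
  define J :: "('a ^ 9) set" where
    "J = {\<Theta> (axis 3 1) 0 0, \<Theta> 0 (axis 3 1) 0, \<Theta> 0 0 (axis 3 1)}"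
  have dec: "x = x $ 1 *s axis 1 1 + x $ 2 *s axis 2 1 + x $ 3 *s axis 3 1" for x :: "'a ^ 3"
    by (simp add: vec_eq_iff forall_3 axis_def)
  have dec\<Theta>: "\<Theta> x y z = x $ 1 *s \<Theta> (axis 1 1) 0 0 + x $ 2 *s \<Theta> (axis 2 1) 0 0
      + y $ 1 *s \<Theta> 0 (axis 1 1) 0 + y $ 2 *s \<Theta> 0 (axis 2 1) 0
      + z $ 1 *s \<Theta> 0 0 (axis 1 1) + z $ 2 *s \<Theta> 0 0 (axis 2 1)
      + (x $ 3 *s \<Theta> (axis 3 1) 0 0 + y $ 3 *s \<Theta> 0 (axis 3 1) 0 + z $ 3 *s \<Theta> 0 0 (axis 3 1))" for x y z
    using dec[of x] dec[of y] dec[of z] by (simp add: \<Theta>_add \<Theta>_scale)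
  have "infinity \<subseteq> vec.span I"
  proof
    fix v assume "v \<in> infinity"
    then obtain x y z where v: "v = \<Theta> x y z" and "x $ 3 = 0" "y $ 3 = 0" "z $ 3 = 0"
      by (auto simp: infinity_def)
    then have "v = x $ 1 *s \<Theta> (axis 1 1) 0 0 + x $ 2 *s \<Theta> (axis 2 1) 0 0
      + y $ 1 *s \<Theta> 0 (axis 1 1) 0 + y $ 2 *s \<Theta> 0 (axis 2 1) 0
      + z $ 1 *s \<Theta> 0 0 (axis 1 1) + z $ 2 *s \<Theta> 0 0 (axis 2 1)"
      using dec\<Theta>[of x y z] by (simp del: \<Theta>_eq_iff)
    also have "\<dots> \<in> vec.span I"
      by (intro vec.span_add vec.span_scale; rule vec.span_base) (simp_all add: I_def del: \<Theta>_eq_iff)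
    finally show "v \<in> vec.span I" .
  qed
  then have "vec.dim infinity \<le> card I"
    by (rule vec.dim_le_card) (simp add: I_def)
  also have "\<dots> \<le> 6"
    using card_length[of "[\<Theta> (axis 1 1) 0 0, \<Theta> (axis 2 1) 0 0, \<Theta> 0 (axis 1 1) 0, \<Theta> 0 (axis 2 1) 0,
      \<Theta> 0 0 (axis 1 1), \<Theta> 0 0 (axis 2 1)]"] by (simp add: I_def del: \<Theta>_eq_iff)
  finally have le: "vec.dim infinity \<le> 6" .
  have "v \<in> vec.span (infinity \<union> J)" for v
  proof -
    obtain x y z where v: "v = \<Theta> x y z" using \<Theta>_surj by blast
    have "\<Theta> (axis i 1) 0 0 \<in> vec.span (infinity \<union> J)" "\<Theta> 0 (axis i 1) 0 \<in> vec.span (infinity \<union> J)"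
      "\<Theta> 0 0 (axis i 1) \<in> vec.span (infinity \<union> J)" for i
      using exhaust_3[of i] by (auto intro!: vec.span_base simp: J_def axis_def[of _ 1] simp del: \<Theta>_eq_iff)
    then show ?thesis
      unfolding v by (subst dec\<Theta>) (intro vec.span_add vec.span_scale)
  qed
  then have "vec.dim (vec.span (infinity \<union> J)) = CARD(9)"
    by (metis UNIV_I subsetI subset_UNIV subset_antisym vec_dim_card)
  then have "9 = vec.dim (infinity \<union> J)" by (simp only: vec.dim_span) simp
  also have "\<dots> \<le> vec.dim infinity + 3"
    by (simp add: J_def vec.dim_insert)
  finally show ?thesis using le by simp
qed

text \<open>S is spanned by rational vectors and exceeds the space at infinity by one dimension, so
  a single rational vector s outside generates the rest. Being fixed by the cyclic Frobenius map, s
  has blocks u, u^q, u^(q^2) with u over the subfield of order q^3; \<delta> is the third coordinate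
  of u.\<close>

lemma six_space_coordinates:
  assumes S: "subspace_over q 1 S" "vec.dim S = 7" "infinity \<subseteq> S"
  obtains \<delta> where "\<delta> \<noteq> 0" "((\<delta> ^ q) ^ q) ^ q = \<delta>"
    "\<And>x y z. \<Theta> x y z \<in> S \<longleftrightarrow> (\<exists>k. x $ 3 = k * \<delta> \<and> y $ 3 = k * \<delta> ^ q \<and> z $ 3 = k * (\<delta> ^ q) ^ q)"
proof -
  have sub: "vec.subspace S" and sp: "vec.span (S \<inter> vecs q 1) = S"
    using S(1) by (auto simp: subspace_over_def)
  have "\<not> S \<inter> vecs q 1 \<subseteq> infinity"
  proof
    assume "S \<inter> vecs q 1 \<subseteq> infinity"
    then have "S \<subseteq> infinity"
      using vec.span_minimal[OF _ subspace_infinity] sp by metis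
    then have "S = infinity" using S(3) by blast
    then show False using S(2) dim_infinity by simp
  qed
  then obtain s where s: "s \<in> S" "frob q s = s" "s \<notin> infinity"
    using in_vecs_1_iff by blast
  obtain u v w where uvw: "s = \<Theta> u v w" using \<Theta>_surj by blast
  have "v = frob q u" "w = frob q (frob q u)" "u = frob q (frob q (frob q u))"
    using s(2) unfolding uvw frob_\<Theta> \<Theta>_eq_iff by metis+
  then have s_eq: "s = \<Theta> u (frob q u) (frob q (frob q u))" and u3: "u = frob q (frob q (frob q u))"
    using uvw by simp_all
  define \<delta> where "\<delta> = u $ 3"
  have "S = vec.span (insert s infinity)"
  proof (rule vec.subspace_dim_equal[symmetric])
    show "vec.span (insert s infinity) \<subseteq> S"
      using s S(3) sub by (intro vec.span_minimal) auto
    have "vec.span infinity = infinity" using subspace_infinity by (rule vec.span_eq_iff[THEN iffD2])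
    then have "s \<notin> vec.span infinity" using s(3) by metis
    then show "vec.dim S \<le> vec.dim (vec.span (insert s infinity))"
      using S(2) by (simp only: vec.dim_span vec.dim_insert dim_infinity) simp
  qed (use sub in auto)
  then have S_eq: "v \<in> S \<longleftrightarrow> (\<exists>k. v - k *s s \<in> infinity)" for v
    using vec.span_insert[of s infinity] vec.span_eq_iff[THEN iffD2, OF subspace_infinity] by auto
  show ?thesis
  proof
    show "\<delta> \<noteq> 0" using s(3) q_pos unfolding s_eq by (auto simp: \<delta>_def)
    show "((\<delta> ^ q) ^ q) ^ q = \<delta>"
      unfolding \<delta>_def by (subst (2) u3) simp
    fix x y z
    have "\<Theta> x y z - k *s s = \<Theta> (x - k *s u) (y - k *s frob q u) (z - k *s frob q (frob q u))" for k
    proof -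
      have "\<Theta> x y z = \<Theta> (x - k *s u) (y - k *s frob q u) (z - k *s frob q (frob q u)) + k *s s"
        by (simp add: s_eq \<Theta>_scale \<Theta>_add)
      then show ?thesis by (simp del: \<Theta>_eq_iff)
    qed
    then show "\<Theta> x y z \<in> S \<longleftrightarrow> (\<exists>k. x $ 3 = k * \<delta> \<and> y $ 3 = k * \<delta> ^ q \<and> z $ 3 = k * (\<delta> ^ q) ^ q)"
      by (simp add: S_eq \<delta>_def)
  qed
qed

lemma scroll_image:
  "scroll x = (\<lambda>v. \<Theta> (v $ 1 *s x) (v $ 2 *s x) (v $ 3 *s x)) ` (UNIV :: ('a ^ 3) set)"
proof -
  have "\<Theta> (a *s x) (b *s x) (c *s x) \<in> range (\<lambda>v::'a ^ 3. \<Theta> (v $ 1 *s x) (v $ 2 *s x) (v $ 3 *s x))" for a b c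
    by (rule image_eqI[of _ _ "vector [a, b, c]"]) simp_all
  then show ?thesis by (auto simp: scroll_def)
qed

lemma subspace_scroll: "vec.subspace (scroll x)"
proof -
  have "Vector_Spaces.linear (*s) (*s) (\<lambda>v::'a ^ 3. \<Theta> (v $ 1 *s x) (v $ 2 *s x) (v $ 3 *s x))"
    by (rule linearI) (simp_all add: \<Theta>_add \<Theta>_scale vec.scale_left_distrib)
  then show ?thesis
    unfolding scroll_image by (intro vec.linear_subspace_image) auto
qed

lemma plane_over_scroll:
  assumes "x \<noteq> 0"
  shows "plane_over q 6 (scroll x)"
proof -
  let ?g = "\<lambda>v::'a ^ 3. \<Theta> (v $ 1 *s x) (v $ 2 *s x) (v $ 3 *s x)"
  have lin: "Vector_Spaces.linear (*s) (*s) ?g"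
    by (rule linearI) (simp_all add: \<Theta>_add \<Theta>_scale vec.scale_left_distrib)
  have inj: "inj ?g"
    using assms by (auto simp: inj_on_def vec_eq_iff[of _ "_ :: 'a ^ 3"] forall_3)
  note sub = subspace_scroll[of x]
  have "vec.dim (scroll x) = vec.dim (UNIV :: ('a ^ 3) set)"
    unfolding scroll_image using lin inj by (intro vec.dim_image_eq) auto
  then have "vec.dim (scroll x) = 3" by (simp only: vec_dim_card) simp
  moreover have "vec.span (scroll x \<inter> vecs q 6) = scroll x"
    using sub by (simp add: Int_absorb2 subset_eq vec.span_eq_iff[THEN iffD2])
  ultimately show ?thesis using sub by (simp add: plane_over_def subspace_over_def)
qed

text \<open>The trace onto \<open>K\<close> is a nonzero polynomial of degree at most q^5, too small
  to vanish on all q^6 elements.\<close>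

lemma trace_nonzero: "\<exists>\<zeta>. \<zeta> + \<zeta> ^ q + (\<zeta> ^ q) ^ q + ((\<zeta> ^ q) ^ q) ^ q + (((\<zeta> ^ q) ^ q) ^ q) ^ q +
    ((((\<zeta> ^ q) ^ q) ^ q) ^ q) ^ q \<noteq> (0::'a)"
proof (rule ccontr)
  assume no: "\<not> ?thesis"
  define R :: "'a poly" where "R = (\<Sum>i<6. Polynomial.monom 1 (q ^ i))"
  have "poly R \<zeta> = 0" for \<zeta>
  proof -
    have "poly R \<zeta> = (\<Sum>i<6. \<zeta> ^ (q ^ i))" by (simp add: R_def poly_sum poly_monom)
    also have "\<dots> = 0" using no by (simp add: numeral_eq_Suc One_nat_def power_mult)
    finally show ?thesis .
  qed
  then have roots: "{\<zeta>. poly R \<zeta> = 0} = UNIV" by simp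
  have "Polynomial.coeff R 1 = (\<Sum>i<6::nat. if i = 0 then 1 else 0)"
    unfolding R_def coeff_sum
  proof (rule sum.cong)
    fix i :: nat
    show "Polynomial.coeff (Polynomial.monom (1::'a) (q ^ i)) 1 = (if i = 0 then 1 else 0)"
    proof (cases "i = 0")
      case False
      then have "1 < q ^ i" using q_gt_1 by (intro one_less_power) auto
      then have "q ^ i \<noteq> 1" by linarith
      then show ?thesis using False by simp
    qed simp
  qed simp
  then have "Polynomial.coeff R 1 = 1" by simp
  then have "R \<noteq> 0" by auto
  then have "CARD('a) \<le> degree R" using card_poly_roots_bound[of R] roots by simp
  also have "degree R \<le> q ^ 5"
    unfolding R_def
  proof (rule degree_sum_le)
    fix i :: nat assume "i \<in> {..<6}"
    then show "degree (Polynomial.monom (1::'a) (q ^ i)) \<le> q ^ 5"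
      using q_pos by (intro order_trans[OF degree_monom_le] power_increasing) auto
  qed simp
  also have "q ^ 5 < q ^ 6" using q_gt_1 by (intro power_strict_increasing) auto
  finally show False using card_UNIV by simp
qed

end

section \<open>The rational plane of the 6-space that carries the conic\<close>

locale bose_section = bose_coordinates q K f0
  for q :: nat and K :: "'a::{field,finite} set" and f0 +
  fixes \<delta> :: 'a
  assumes \<delta>_nonzero [simp]: "\<delta> \<noteq> 0" and \<delta>_q3 [simp]: "((\<delta> ^ q) ^ q) ^ q = \<delta>"
begin

text \<open>The Frobenius map permutes the three weights cyclically along with the blocks, so D
  commutes with it and the plane \<open>range D\<close> is defined over \<open>K\<close>.\<close>

definition D :: "'a ^ 3 \<Rightarrow> 'a ^ 9" where
  "D x = \<Theta> (\<delta> *s x) (\<delta> ^ q *s x) ((\<delta> ^ q) ^ q *s x)"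

lemma D_linear: "Vector_Spaces.linear (*s) (*s) D"
  by (rule linearI) (simp_all add: D_def \<Theta>_add \<Theta>_scale vec.scale_right_distrib mult.commute)

lemma D_eq_iff [simp]: "D x = D y \<longleftrightarrow> x = y"
  by (simp add: D_def)

lemma D_eq_0_iff [simp]: "D x = 0 \<longleftrightarrow> x = 0"
  by (simp add: D_def)

lemma D_scale: "D (c *s x) = c *s D x"
  by (rule vec.linear_scale[OF D_linear])

lemma frob_D: "frob q (D x) = D (frob q x)"
  by (simp add: D_def frob_\<Theta> frob_scale)

lemma D_in_scroll: "D x \<in> scroll x"
  by (auto simp: D_def scroll_def)

lemma D_in_infinity [simp]: "D x \<in> infinity \<longleftrightarrow> x $ 3 = 0"
  by (simp add: D_def)

lemma D_in_span_iff: "D x \<in> vec.span {D y} \<longleftrightarrow> x \<in> vec.span {y}"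
  by (auto simp: span_1 image_iff simp flip: D_scale)

lemma plane_over_range_D: "plane_over q 1 (range D)"
proof -
  have sub: "vec.subspace (range D)"
    using D_linear by (intro vec.linear_subspace_image) auto
  have "vec.dim (range D) = vec.dim (UNIV :: ('a ^ 3) set)"
    using D_linear by (intro vec.dim_image_eq) (auto simp: inj_on_def)
  then have "vec.dim (range D) = 3" by (simp only: vec_dim_card) simp
  moreover have "vec.span (range D \<inter> vecs q 1) = range D"
  proof
    show "vec.span (range D \<inter> vecs q 1) \<subseteq> range D"
      using sub by (intro vec.span_minimal) auto
    show "range D \<subseteq> vec.span (range D \<inter> vecs q 1)"
    proof safe
      fix x
      have "D x = (\<Sum>i\<in>UNIV. x $ i *s D (axis i 1))"
      proof -
        have "D x = D (\<Sum>i\<in>UNIV. x $ i *s axis i 1)" by (simp only: basis_expansion)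
        then show ?thesis by (simp only: vec.linear_sum[OF D_linear] vec.linear_scale[OF D_linear])
      qed
      also have "\<dots> \<in> vec.span (range D \<inter> vecs q 1)"
        by (intro vec.span_sum vec.span_scale vec.span_base) (auto simp: in_vecs_1_iff frob_D)
      finally show "D x \<in> vec.span (range D \<inter> vecs q 1)" .
    qed
  qed
  ultimately show ?thesis using sub by (simp add: plane_over_def subspace_over_def)
qed

text \<open>The projection \<open>\<Theta> x y z \<mapsto> \<eta> x + \<eta>\<^sup>q y + \<eta>\<^bsup>q\<^sup>2\<^esup> z\<close> with \<open>\<eta>\<close> in the subfield of order
  \<open>q\<^sup>3\<close> commutes with the Frobenius map, hence is defined over \<open>K\<close>; it is invertible on the plane
  iff \<open>\<eta> \<delta>\<close> has nonzero trace.\<close>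
lemma plane_form:
  assumes N: "N \<in> mats q 1"
  obtains M \<tau> where "M \<in> mats q 1" "\<tau> \<noteq> 0"
    "\<And>x. qform M (D x) = \<tau> * qform N x" "\<And>x y. polar_form M (D x) (D y) = \<tau> * polar_form N x y"
proof -
  obtain \<zeta> where \<zeta>: "\<zeta> + \<zeta> ^ q + (\<zeta> ^ q) ^ q + ((\<zeta> ^ q) ^ q) ^ q + (((\<zeta> ^ q) ^ q) ^ q) ^ q +
    ((((\<zeta> ^ q) ^ q) ^ q) ^ q) ^ q \<noteq> (0::'a)" using trace_nonzero by blast
  \<comment> \<open>The sum \<zeta> + \<zeta>^(q^3) lies in the subfield of order q^3, and so does
    its quotient by \<delta>. The three conjugates of \<eta> \<delta> then add up to the full
    six-term trace of \<zeta>, so t is nonzero.\<close>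
  define \<eta> where "\<eta> = (\<zeta> + ((\<zeta> ^ q) ^ q) ^ q) / \<delta>"
  define t where "t = \<eta> * \<delta> + \<eta> ^ q * \<delta> ^ q + (\<eta> ^ q) ^ q * (\<delta> ^ q) ^ q"
  have "\<eta> * \<delta> = \<zeta> + ((\<zeta> ^ q) ^ q) ^ q" by (simp add: \<eta>_def)
  then have t: "t \<noteq> 0"
    using \<zeta> unfolding t_def power_mult_distrib[symmetric] by (simp add: add_power_q add_ac)
  have \<eta>: "((\<eta> ^ q) ^ q) ^ q = \<eta>"
    by (simp add: \<eta>_def power_divide add_power_q add.commute)
  define p where "p v = (SOME (x, y, z). v = \<Theta> x y z)" for v
  have p: "p (\<Theta> x y z) = (x, y, z)" for x y z
    unfolding p_def by (rule some_equality) auto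
  define \<rho> where "\<rho> v = (case p v of (x, y, z) \<Rightarrow> \<eta> *s x + \<eta> ^ q *s y + (\<eta> ^ q) ^ q *s z)" for v
  have \<rho>: "\<rho> (\<Theta> x y z) = \<eta> *s x + \<eta> ^ q *s y + (\<eta> ^ q) ^ q *s z" for x y z
    by (simp add: \<rho>_def p)
  have lin: "Vector_Spaces.linear (*s) (*s) \<rho>"
  proof (rule linearI)
    fix v w c
    obtain x y z x' y' z' where v: "v = \<Theta> x y z" and w: "w = \<Theta> x' y' z'" using \<Theta>_surj by metis
    show "\<rho> (v + w) = \<rho> v + \<rho> w" by (simp add: v w \<Theta>_add \<rho> vec.scale_right_distrib)
    show "\<rho> (c *s v) = c *s \<rho> v" by (simp add: v \<Theta>_scale \<rho> vec.scale_right_distrib mult.commute)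
  qed
  have frob\<rho>: "frob q (\<rho> v) = \<rho> (frob q v)" for v
  proof -
    obtain x y z where v: "v = \<Theta> x y z" using \<Theta>_surj by blast
    show ?thesis by (simp add: v \<rho> frob_\<Theta> frob_add frob_scale \<eta> add_ac)
  qed
  define R where "R = matrix \<rho>"
  have R: "R *v v = \<rho> v" for v unfolding R_def by (rule matrix_works[OF lin])
  have R1: "R \<in> mats q 1"
    unfolding mats_iff_frob by (simp add: R One_nat_def frob\<rho>)
  have RD: "R *v D x = t *s x" for x
    by (simp add: R D_def \<rho> t_def vec.scale_left_distrib mult.commute)
  show ?thesis
  proof
    show "transpose R ** N ** R \<in> mats q 1"
      using R1 N by (intro mats_mult transpose_mats)
    show "t\<^sup>2 \<noteq> 0" using t by simp
    show "qform (transpose R ** N ** R) (D x) = t\<^sup>2 * qform N x" for x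
      by (simp add: qform_congruence RD qform_scale)
    show "polar_form (transpose R ** N ** R) (D x) (D y) = t\<^sup>2 * polar_form N x y" for x y
      by (simp add: polar_congruence RD polar_linear power2_eq_square mult.assoc)
  qed
qed

end

section \<open>Conjugacy maps and the section\<close>

context frobenius_field
begin

lemma span_scale_eq: "c \<noteq> 0 \<Longrightarrow> vec.span {c *s v} = vec.span {v :: 'a ^ 'n}"
  by (cases "v = 0") (auto simp: span_1_eq_iff intro: vec.span_scale vec.span_base)

lemma span_image_eq_iff:
  assumes g: "Vector_Spaces.linear (*s) (*s) (g :: 'a ^ 'n \<Rightarrow> 'a ^ 'm)" "inj g" and "x \<noteq> 0" "y \<noteq> 0"
  shows "vec.span {g x} = vec.span {g y} \<longleftrightarrow> x \<in> vec.span {y}"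
proof -
  have "g x \<noteq> 0" "g y \<noteq> 0"
    using assms(3,4) injD[OF g(2), of _ 0] vec.linear_0[OF g(1)] by auto
  then have "vec.span {g x} = vec.span {g y} \<longleftrightarrow> g x \<in> vec.span {g y}"
    by (rule span_1_eq_iff)
  also have "\<dots> \<longleftrightarrow> x \<in> vec.span {y}"
    unfolding image_span_1[OF g(1), symmetric] by (rule inj_image_mem_iff[OF g(2)])
  finally show ?thesis .
qed

text \<open>The map c determines m only up to a scalar at each point. Fixing the rational points
  supported on \<open>I\<close> forces m to preserve the axis points and their unit point, so there
  m is a constant multiple of the Frobenius map, and the constant disappears on points.\<close>

lemma conj_eq_frob:
  fixes A :: "'a ^ 'n ^ 'm" and m :: "'a ^ 'n \<Rightarrow> 'a ^ 'n"
  assumes inj: "inj ((*v) A)"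
    and add: "\<And>x y. m (x + y) = m x + m y" and scale: "\<And>c x. m (c *s x) = c ^ q *s m x"
    and c: "\<And>x. x \<noteq> 0 \<Longrightarrow> (\<And>i. i \<notin> I \<Longrightarrow> x $ i = 0) \<Longrightarrow>
      c (vec.span {A *v x}) = vec.span {A *v m x}"
    and fixed: "\<And>x. x \<in> vecs q 1 \<Longrightarrow> x \<noteq> 0 \<Longrightarrow> (\<And>i. i \<notin> I \<Longrightarrow> x $ i = 0) \<Longrightarrow>
      c (vec.span {A *v x}) = vec.span {A *v x}"
    and x: "x \<noteq> 0" "\<And>i. i \<notin> I \<Longrightarrow> x $ i = 0"
  shows "c (vec.span {A *v x}) = vec.span {A *v frob q x}"
proof -
  have rat: "m y \<in> vec.span {y}" "m y \<noteq> 0"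
    if y: "y \<in> vecs q 1" "y \<noteq> 0" "\<And>i. i \<notin> I \<Longrightarrow> y $ i = 0" for y
  proof -
    have e: "vec.span {A *v m y} = vec.span {A *v y}"
      using c[OF y(2,3)] fixed[OF y] by simp
    have "A *v y \<noteq> 0" using y(2) injD[OF inj, of y 0] by auto
    moreover have "A *v y \<in> vec.span {A *v y}" by (rule vec.span_base) simp
    ultimately show "m y \<noteq> 0" unfolding e[symmetric] by force
    then show "m y \<in> vec.span {y}"
      using span_image_eq_iff[of "(*v) A" "m y" y] e y(2) inj by simp
  qed
  obtain i where i: "x $ i \<noteq> 0" using x(1) by (auto simp: vec_eq_iff)
  then have iI: "i \<in> I" using x(2) by blast
  define u :: "'a ^ 'n" where "u = (\<Sum>i\<in>I. axis i 1)"
  have u: "u $ j = (if j \<in> I then 1 else 0)" for j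
    by (simp add: u_def axis_def if_distrib sum.delta cong: if_cong)
  have supp: "axis j (1::'a) $ i = 0" if "j \<in> I" "i \<notin> I" for i j
    using that by (auto simp: axis_def)
  have ax: "m (axis j 1) \<in> vec.span {axis j 1}" if "j \<in> I" for j
    using that supp by (intro rat vecs_1_closed) auto
  have un: "m u \<in> vec.span {u}"
  proof (intro rat)
    show "u \<in> vecs q 1" by (simp add: in_vecs_1_iff_K u)
    show "u \<noteq> 0" using iI u[of i] by auto
  qed (simp add: u)
  obtain \<mu> where \<mu>: "\<And>x. (\<And>i. i \<notin> I \<Longrightarrow> x $ i = 0) \<Longrightarrow> m x = \<mu> *s frob q x"
    using semilinear_eq_scaled_frob[of m I, OF add scale ax un[unfolded u_def]] by blast
  have "m (axis i 1) \<noteq> 0"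
    using iI supp by (intro rat vecs_1_closed) auto
  moreover have "m (axis i 1) = \<mu> *s frob q (axis i 1)"
    using iI supp by (intro \<mu>) auto
  ultimately have "\<mu> \<noteq> 0" by auto
  have "c (vec.span {A *v x}) = vec.span {A *v m x}" by (rule c[OF x])
  also have "m x = \<mu> *s frob q x" by (rule \<mu>[OF x(2)])
  also have "A *v (\<mu> *s frob q x) = \<mu> *s (A *v frob q x)" by (rule vec.scale)
  also have "vec.span {\<dots>} = vec.span {A *v frob q x}" by (rule span_scale_eq[OF \<open>\<mu> \<noteq> 0\<close>])
  finally show ?thesis .
qed

lemma subplane_conj_coordinates:
  fixes A :: "'a ^ 3 ^ 3"
  assumes conj: "subplane_conj q B c" and A: "bij ((*v) A)"
    and B: "\<And>x. x \<in> vecs q 1 \<Longrightarrow> x \<noteq> 0 \<Longrightarrow> vec.span {A *v x} \<in> B" and x: "x \<noteq> 0"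
  shows "c (vec.span {A *v x}) = vec.span {A *v frob q x}"
proof -
  obtain M :: "'a ^ 3 ^ 3" where M: "\<forall>X\<in>PG q 6. c X = (\<lambda>v. M *v frob q v) ` X"
    and fixed: "\<forall>X\<in>B. c X = X"
    using conj unfolding subplane_conj_def by (elim conjE bexE)
  obtain g where g: "Vector_Spaces.linear (*s) (*s) g" "(*v) A \<circ> g = id"
    using vec.linear_surjective_right_inverse[of "(*v) A"] bij_is_surj[OF A] by auto
  have Ag: "A *v g y = y" for y using g(2) by (simp add: fun_eq_iff)
  have cM: "c (vec.span {A *v x}) = vec.span {A *v g (M *v frob q (A *v x))}" if "x \<noteq> 0" for x
  proof -
    have "A *v x \<noteq> 0" using that injD[OF bij_is_inj[OF A], of x 0] by auto
    then have "vec.span {A *v x} \<in> PG q 6" by (auto simp: PG_6)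
    then have "c (vec.span {A *v x}) = (*v) M ` frob q ` vec.span {A *v x}"
      by (simp add: M[rule_format] image_image)
    then show ?thesis by (simp add: frob_image_span_1 image_span_1 Ag)
  qed
  show ?thesis
  proof (rule conj_eq_frob[where I = UNIV and m = "\<lambda>x. g (M *v frob q (A *v x))"])
    show "inj ((*v) A)" using A by (rule bij_is_inj)
  qed (use x cM B fixed in \<open>simp_all add: matrix_vector_right_distrib frob_add frob_scale vec.scale
      vec.linear_add[OF g(1)] vec.linear_scale[OF g(1)]\<close>)
qed

text \<open>The given parametrisation J of L is unrelated to A; a left inverse h of J and a right
  inverse g of A pass between them. The composite is semilinear on the whole space but represents c
  only on vectors of L, hence the frame of the first two axes.\<close>

lemma subline_conj_coordinates:
  fixes A :: "'a ^ 3 ^ 3"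
  assumes conj: "subline_conj q L b c" and A: "bij ((*v) A)" and L: "L = (*v) A ` {x. x $ 3 = 0}"
    and b: "\<And>x. x \<in> vecs q 1 \<Longrightarrow> x \<noteq> 0 \<Longrightarrow> x $ 3 = 0 \<Longrightarrow> vec.span {A *v x} \<in> b"
    and x: "x \<noteq> 0" "x $ 3 = 0"
  shows "c (vec.span {A *v x}) = vec.span {A *v frob q x}"
proof -
  obtain J :: "'a ^ 2 ^ 3" and D :: "'a ^ 2 ^ 2" where J: "inj ((*v) J)" "range ((*v) J) = L"
    and D: "\<forall>X\<in>pts q 6 L. c X = (\<lambda>y. J *v (D *v frob q y)) ` {y. J *v y \<in> X}"
    and fixed: "\<forall>X\<in>b. c X = X"
    using conj unfolding subline_conj_def by (elim conjE exE bexE)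
  obtain g where g: "Vector_Spaces.linear (*s) (*s) g" "(*v) A \<circ> g = id"
    using vec.linear_surjective_right_inverse[of "(*v) A"] bij_is_surj[OF A] by auto
  have Ag: "A *v g y = y" for y using g(2) by (simp add: fun_eq_iff)
  obtain h where h: "Vector_Spaces.linear (*s) (*s) h" "h \<circ> (*v) J = id"
    using vec.linear_injective_left_inverse[of "(*v) J"] J(1) by auto
  have hJ: "h (J *v y) = y" for y using h(2) by (simp add: fun_eq_iff)
  have cD: "c (vec.span {A *v x}) = vec.span {A *v g (J *v (D *v frob q (h (A *v x))))}"
    if x: "x \<noteq> 0" "x $ 3 = 0" for x
  proof -
    have "A *v x \<noteq> 0" using x injD[OF bij_is_inj[OF A], of x 0] by auto
    moreover have sp: "vec.span {A *v x} \<subseteq> L"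
      using x unfolding L span_1 by (auto simp flip: vec.scale)
    ultimately have X: "vec.span {A *v x} \<in> pts q 6 L" by (auto simp: pts_def PG_6)
    have "A *v x \<in> L" using x L by auto
    then obtain y where y: "A *v x = J *v y" using J(2) by blast
    have "{z. J *v z \<in> vec.span {J *v y}} = vec.span {y}"
      using J(1) by (auto simp: span_1 inj_eq simp flip: vec.scale)
    then have "{z. J *v z \<in> vec.span {A *v x}} = vec.span {h (A *v x)}"
      by (simp add: y hJ)
    then have "c (vec.span {A *v x}) = (*v) J ` (*v) D ` frob q ` vec.span {h (A *v x)}"
      by (simp add: D[rule_format, OF X] image_image)
    then show ?thesis by (simp add: frob_image_span_1 image_span_1 Ag)
  qed
  have I: "(\<forall>i. i \<notin> {1, 2} \<longrightarrow> x $ i = 0) \<longleftrightarrow> x $ 3 = 0" for x :: "'a ^ 3"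
    by (auto simp: forall_3)
  have I3: "x $ 3 = 0" if "\<And>i. i \<notin> {1, 2} \<Longrightarrow> x $ i = 0" for x :: "'a ^ 3"
    using that I by blast
  show ?thesis
  proof (rule conj_eq_frob[where I = "{1, 2}" and m = "\<lambda>x. g (J *v (D *v frob q (h (A *v x))))"])
    show "inj ((*v) A)" using A by (rule bij_is_inj)
    show "c (vec.span {A *v x}) = vec.span {A *v g (J *v (D *v frob q (h (A *v x))))}"
      if "x \<noteq> 0" "\<And>i. i \<notin> {1, 2} \<Longrightarrow> x $ i = 0" for x
      using cD that I3 by blast
    show "c (vec.span {A *v x}) = vec.span {A *v x}"
      if "x \<in> vecs q 1" "x \<noteq> 0" "\<And>i. i \<notin> {1, 2} \<Longrightarrow> x $ i = 0" for x
      using fixed b that I3 by blast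
    show "x $ i = 0" if "i \<notin> {1, 2}" for i
      using that x(2) I by blast
  qed (use x in \<open>simp_all add: matrix_vector_right_distrib frob_add frob_scale vec.scale
      vec.linear_add[OF g(1)] vec.linear_scale[OF g(1)] vec.linear_add[OF h(1)] vec.linear_scale[OF h(1)]\<close>)
qed

lemma subspace_span_subset_iff: "vec.subspace U \<Longrightarrow> vec.span {v :: 'a ^ 'n} \<subseteq> U \<longleftrightarrow> v \<in> U"
  by (auto intro: vec.span_base vec.span_minimal[THEN subsetD])

end

context bose_coordinates
begin

lemma scroll_cong: "vec.span {x} = vec.span {y} \<Longrightarrow> scroll x = scroll y"
  by (simp only: scroll_eq_span flip: frob_iter_image_span_1)

lemma scroll_subset_infinity: "x $ 3 = 0 \<Longrightarrow> scroll x \<subseteq> infinity"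
  by (auto simp: scroll_def)

lemma transversal_line:
  assumes "i < 3"
  shows "((`) (frob q) ^^ i) (f0 ` {x. x $ 3 = 0}) \<subseteq>
    {\<Theta> (if i = 0 then x else 0) (if i = 1 then x else 0) (if i = 2 then x else 0) | x. True}"
proof -
  have *: "f0 x = \<Theta> x 0 0" "f1 x = \<Theta> 0 x 0" "f2 x = \<Theta> 0 0 x" for x
    by (simp_all add: \<Theta>_def f_simps)
  have "i = 0 \<or> i = 1 \<or> i = 2" using assms by auto
  then show ?thesis
    by (elim disjE) (auto simp: numeral_2_eq_2 One_nat_def * frob_\<Theta>)
qed

end

context bose_section
begin

text \<open>Each transversal line occupies one of the three blocks. A line meeting two of them is
  spanned by the two meeting points and has a zero third block, whereas all blocks of
  \<open>D x\<close> are nonzero multiples of x.\<close>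

lemma D_not_on_T_line:
  assumes x: "x \<noteq> 0" and T: "vec.subspace T" "vec.dim T = 2"
    and ij: "i < 3" "j < 3" "i \<noteq> j"
    and u: "u \<in> T" "u \<noteq> 0" "u \<in> ((`) (frob q) ^^ i) (f0 ` {x. x $ 3 = 0})"
    and w: "w \<in> T" "w \<noteq> 0" "w \<in> ((`) (frob q) ^^ j) (f0 ` {x. x $ 3 = 0})"
  shows "D x \<notin> T"
proof
  assume "D x \<in> T"
  obtain a where a: "u = \<Theta> (if i = 0 then a else 0) (if i = 1 then a else 0) (if i = 2 then a else 0)"
    using transversal_line[OF ij(1)] u(3) by blast
  obtain b where b: "w = \<Theta> (if j = 0 then b else 0) (if j = 1 then b else 0) (if j = 2 then b else 0)"
    using transversal_line[OF ij(2)] w(3) by blast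
  have cases: "i = 0 \<or> i = 1 \<or> i = 2" "j = 0 \<or> j = 1 \<or> j = 2" using ij by auto
  have "u \<notin> vec.span {w}"
    using u(2) cases ij(3) by (auto simp: span_1 a b \<Theta>_scale)
  then have "vec.independent {u, w}" "u \<noteq> w"
    using w(2) vec.span_base[of w "{w}"] by (auto simp: vec.independent_insert)
  then have "T \<subseteq> vec.span {u, w}"
    using u(1) w(1) T(2) by (intro vec.card_ge_dim_independent) auto
  then have "D x \<in> vec.span {u, w}" using \<open>D x \<in> T\<close> by blast
  then obtain k l where "D x = k *s u + l *s w"
    by (auto simp: vec.span_insert[of u "{w}"] span_1 diff_eq_eq add.commute)
  then show False
    using cases ij(3) x by (auto simp: D_def a b \<Theta>_add \<Theta>_scale)
qed

text \<open>In a scroll-plane with nonzero third coordinate of x, membership in S fixes the three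
  block multipliers up to a common factor. Otherwise it holds throughout the plane, and
  \<open>pr\<close> leaves only the points of p and r, which may coincide.\<close>

lemma section_decomposition:
  assumes S: "\<And>x y z. \<Theta> x y z \<in> S \<longleftrightarrow>
      (\<exists>k. x $ 3 = k * \<delta> \<and> y $ 3 = k * \<delta> ^ q \<and> z $ 3 = k * (\<delta> ^ q) ^ q)"
    and M: "\<tau> \<noteq> 0" "\<And>x. qform M (D x) = \<tau> * qform N x"
    and p: "p \<noteq> 0" "p $ 3 = 0" "qform N p = 0" and r: "r \<noteq> 0" "r $ 3 = 0" "qform N r = 0"
    and pr: "\<And>x. x \<noteq> 0 \<Longrightarrow> x $ 3 = 0 \<Longrightarrow> qform N x = 0 \<Longrightarrow> x \<in> vec.span {p} \<or> x \<in> vec.span {r}"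
    and v: "v \<noteq> 0"
  shows "(\<exists>x. x \<noteq> 0 \<and> qform N x = 0 \<and> v \<in> scroll x) \<and> v \<in> S \<longleftrightarrow>
    v \<in> range D \<and> qform M v = 0 \<or> v \<in> scroll p \<or> v \<in> scroll r"
proof
  assume "(\<exists>x. x \<noteq> 0 \<and> qform N x = 0 \<and> v \<in> scroll x) \<and> v \<in> S"
  then obtain x a b c where x: "x \<noteq> 0" "qform N x = 0" and v_eq: "v = \<Theta> (a *s x) (b *s x) (c *s x)"
    and vs: "v \<in> scroll x" and "v \<in> S"
    by (auto simp: scroll_def)
  then obtain k where k: "a * x $ 3 = k * \<delta>" "b * x $ 3 = k * \<delta> ^ q" "c * x $ 3 = k * (\<delta> ^ q) ^ q"
    by (auto simp: S)
  show "v \<in> range D \<and> qform M v = 0 \<or> v \<in> scroll p \<or> v \<in> scroll r"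
  proof (cases "x $ 3 = 0")
    case True
    then have "x \<in> vec.span {p} \<or> x \<in> vec.span {r}" using pr x by blast
    then have "scroll x = scroll p \<or> scroll x = scroll r"
      using scroll_cong[of x p] scroll_cong[of x r] x(1) p(1) r(1) by (auto simp: span_1_eq_iff)
    then show ?thesis using vs by auto
  next
    case False
    have "a = k / x $ 3 * \<delta>" "b = k / x $ 3 * \<delta> ^ q" "c = k / x $ 3 * (\<delta> ^ q) ^ q"
      using k False by (simp_all add: field_simps)
    then have "v = D ((k / x $ 3) *s x)"
      unfolding v_eq D_def by (simp add: mult.commute)
    then show ?thesis using M x(2) by (simp add: qform_scale)
  qed
next
  have scroll_S: "v \<in> S" if "v \<in> scroll y" "y $ 3 = 0" for y
    using that by (auto simp: scroll_def S)
  assume "v \<in> range D \<and> qform M v = 0 \<or> v \<in> scroll p \<or> v \<in> scroll r"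
  then consider x where "v = D x" "qform M v = 0" | "v \<in> scroll p" | "v \<in> scroll r" by blast
  then show "(\<exists>x. x \<noteq> 0 \<and> qform N x = 0 \<and> v \<in> scroll x) \<and> v \<in> S"
  proof cases
    case 1
    have "v \<in> S" unfolding 1(1) D_def S by (auto intro!: exI[of _ "x $ 3"])
    then show ?thesis using 1 M v D_in_scroll[of x] by auto
  qed (use p r scroll_S in blast)+
qed

end

section \<open>Return from coordinates to the given configuration\<close>

theorem corollary4p2:
  fixes q :: nat
    and L :: "('a::{field,finite} ^ 3) set"
    and B C Cp Cpp :: "('a ^ 3) set set"
    and P Q :: "('a ^ 3) set"
    and cB cb :: "('a ^ 3) set \<Rightarrow> ('a ^ 3) set"
    and G S6 :: "('a ^ 9) set"
    and f :: "'a ^ 3 \<Rightarrow> 'a ^ 9"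
    and F :: "nat \<Rightarrow> 'a ^ 9 ^ 9"
  defines "Sinf \<equiv> bose q f L"
  assumes "primepow q" and "q \<ge> 6" and "CARD('a) = q ^ 6"
    and "line_over q 3 L"
    and "fq_subplane q B" and "card (B \<inter> pts q 3 L) = q + 1"
    and "fq_conic_in q B C"
    and "nd_conic q 3 Cp" and "C \<subseteq> Cp"
    and "nd_conic q 6 Cpp" and "Cp \<subseteq> Cpp"
    and "Cpp \<inter> pts q 6 L = {P, Q}"
    and "subplane_conj q B cB"
    and "subline_conj q L (B \<inter> pts q 3 L) cb"
    and "bose_plane q G" and "identification q G f"
    and "subspace_over q 1 S6" and "vec.dim S6 = 7" and "Sinf \<subseteq> S6"
    and "conic_variety q f cB C Cp Cpp F"
  shows "\<exists>E N \<alpha> \<beta>.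
     \<comment> \<open>the conic N2: form N in the plane E\<close>
     plane_over q 1 E \<and> E \<subseteq> S6 \<and> \<not> E \<subseteq> Sinf \<and>
     card {S \<in> spread q f L. pts q 1 E \<inter> S \<noteq> {}} = q + 1 \<and>
     N \<in> mats q 1 \<and> nondegenerate_on E N \<and>
     \<comment> \<open>the two planes at infinity\<close>
     plane_over q 6 \<alpha> \<and> \<alpha> \<subseteq> Sinf \<and> plane_over q 6 \<beta> \<and> \<beta> \<subseteq> Sinf \<and>
     (\<forall>k\<in>{1, 3, 6}.
        section_pts q k F S6 = conic_pts q k E N \<union> pts q k \<alpha> \<union> pts q k \<beta>) \<and>
     (C \<inter> pts q 3 L = {P, Q} \<longrightarrow>
        \<alpha> = bose q f P \<and> \<beta> = bose q f Q \<and>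
        pts q 1 (bose q f P) \<in> spread q f L \<and> pts q 1 (bose q f Q) \<in> spread q f L \<and>
        pts q 1 (bose q f P) \<union> pts q 1 (bose q f Q) \<subseteq> section_pts q 1 F S6 \<and>
        (\<exists>R S. R \<in> pts q 1 (bose q f P) \<and> S \<in> pts q 1 (bose q f Q) \<and> (R = S \<longleftrightarrow> P = Q) \<and>
           conic_pts q 1 E N \<inter> pts q 1 Sinf = {R, S} \<and>
           conic_pts q 6 E N \<inter> pts q 6 Sinf = {R, S})) \<and>
     (C \<inter> pts q 3 L = {} \<longrightarrow>
        Cp \<inter> pts q 3 L = {} \<and>
        {P, Q} \<subseteq> pts q 6 L - pts q 3 L \<and> P \<noteq> Q \<and>
        \<alpha> = scroll_plane q f cb P \<and> \<beta> = scroll_plane q f cb Q \<and>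
        pts q 6 (scroll_plane q f cb P) \<union> pts q 6 (scroll_plane q f cb Q)
          \<subseteq> section_pts q 6 F S6 \<and>
        (\<exists>K. conic_pts q 6 E N \<inter> pts q 6 Sinf = {K, frob q ` K} \<and> K \<noteq> frob q ` K \<and>
           {K, frob q ` K} \<subseteq> pts q 6 Sinf - pts q 3 Sinf \<and>
           (\<forall>T. T_line q f L T \<longrightarrow> \<not> K \<subseteq> T)))"
proof -
  define Fq where "Fq = {x :: 'a. x ^ q = x}"
  interpret frobenius_field q Fq
    using assms(2,4) Fq_def by unfold_locales
  have card_BL: "card (B \<inter> pts q 3 L) \<ge> 2" using assms(3,7) by simp
  obtain A N :: "'a ^ 3 ^ 3" where A3: "A \<in> mats q 3" and bijA: "bij ((*v) A)"
    and N1: "N \<in> mats q 1" and N_nd: "nondegenerate_on UNIV N"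
    and B_eq: "B = {vec.span {A *v x} | x. x \<in> vecs q 1 \<and> x \<noteq> 0}"
    and C_eq: "C = {vec.span {A *v x} | x. x \<in> vecs q 1 \<and> x \<noteq> 0 \<and> qform N x = 0}"
    and L_eq: "L = (*v) A ` {x. x $ 3 = 0}"
    by (rule fq_conic_coordinates[OF assms(8) assms(5) card_BL])
  have injA: "inj ((*v) A)" and surjA: "\<And>y. \<exists>x. y = A *v x"
    using bijA by (auto simp: bij_def dest: surjD)
  have A_nonzero: "A *v x \<noteq> 0" if "x \<noteq> 0" for x
    using that injD[OF injA, of x 0] by auto
  have A_span: "vec.span {A *v x} = vec.span {A *v y} \<longleftrightarrow> x \<in> vec.span {y}" if "x \<noteq> 0" "y \<noteq> 0" for x y
    using that injA by (intro span_image_eq_iff) auto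
  have ptE: "\<exists>x. x \<noteq> 0 \<and> X = vec.span {A *v x}" if X: "X \<in> PG q k" for X and k
  proof -
    obtain y where "y \<noteq> 0" "X = vec.span {y}" using X by (auto simp: PG_def)
    moreover obtain x where "y = A *v x" using surjA by blast
    ultimately show ?thesis by (intro exI[of _ x]) auto
  qed

  have f_lin: "Vector_Spaces.linear (*s) (*s) f" and "inj f" and f_range: "range f = G"
    and f_vecs: "f ` vecs q 3 = G \<inter> vecs q 3"
    using assms(17) by (auto simp: identification_def)
  \<comment> \<open>Precomposing with A puts the subplane in standard position, where its conjugacy
    map is the Frobenius map of the source.\<close>
  define f0 where "f0 x = f (A *v x)" for x
  have f0_range: "range f0 = G"
    using bij_is_surj[OF bijA] by (simp add: f0_def f_range flip: image_image)
  have f0_lin: "Vector_Spaces.linear (*s) (*s) f0"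
    using vec.linear_add[OF f_lin] vec.linear_scale[OF f_lin]
    by (intro Vector_Spaces.linear_iff[THEN iffD2])
      (simp add: vec.vector_space_axioms f0_def matrix_vector_right_distrib vec.scale)
  interpret bose_coordinates q Fq f0
  proof (intro bose_coordinates.intro bose_coordinates_axioms.intro frobenius_field_axioms)
    show "Vector_Spaces.linear (*s) (*s) f0" by (rule f0_lin)
    show "vec.span (range f0 \<union> frob q ` range f0 \<union> frob q ` frob q ` range f0) = UNIV"
      using assms(16) by (simp add: f0_range bose_plane_def frob_span_def)
    have "f0 (axis i 1) \<in> vecs q 3" for i
    proof -
      have "A *v axis i 1 \<in> vecs q 3"
        using frob_iter_mats[OF A3, of "axis i 1"] by (simp add: in_vecs_iff numeral_3_eq_3)
      then show ?thesis using f_vecs by (auto simp: f0_def)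
    qed
    then show "frob q (frob q (frob q (f0 x))) = f0 (frob q (frob q (frob q x)))" for x
      using frob_iter_linear[OF f0_lin, of 3 x] by (simp add: numeral_3_eq_3)
  qed
  have f_pt: "f ` vec.span {A *v x} = f0 ` vec.span {x}" for x
    unfolding image_span_1[OF f_lin] image_span_1[OF f0_lin] by (simp only: f0_def)
  have f_L: "f ` L = f0 ` {x. x $ 3 = 0}"
    unfolding L_eq by (simp add: image_image f0_def)
  have Sinf: "Sinf = infinity"
    unfolding Sinf_def bose_def f_L by (rule frob_span_line)
  have S6_sub: "vec.subspace S6" using assms(18) by (simp add: subspace_over_def)
  obtain \<delta> where \<delta>: "\<delta> \<noteq> 0" "((\<delta> ^ q) ^ q) ^ q = \<delta>" and S6:
    "\<And>x y z. \<Theta> x y z \<in> S6 \<longleftrightarrow> (\<exists>k. x $ 3 = k * \<delta> \<and> y $ 3 = k * \<delta> ^ q \<and> z $ 3 = k * (\<delta> ^ q) ^ q)"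
    using six_space_coordinates[OF assms(18,19)] assms(20) unfolding Sinf by blast
  interpret bose_section q Fq f0 \<delta>
    using \<delta> by unfold_locales
  obtain M \<tau> where M1: "M \<in> mats q 1" and \<tau>: "\<tau> \<noteq> 0"
    and M: "\<And>x. qform M (D x) = \<tau> * qform N x"
    and M_polar: "\<And>x y. polar_form M (D x) (D y) = \<tau> * polar_form N x y"
    using plane_form[OF N1] by blast

  obtain N2 where N2: "nondegenerate_on UNIV N2" "Cpp = conic_pts q 6 UNIV N2"
    using assms(11) unfolding nd_conic_def by blast
  \<comment> \<open>The form \<open>N2\<close> may have coefficients in the largest field. Its
    pullback along A vanishes at the rational zeros of N, because C lies in \<open>Cpp\<close>, and
    this forces equality of the two zero sets.\<close>
  have Cpp_iff: "vec.span {A *v x} \<in> Cpp \<longleftrightarrow> qform N x = 0" if x: "x \<noteq> 0" for x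
  proof -
    have *: "vec.span {A *v x} \<in> Cpp \<longleftrightarrow> qform (transpose A ** N2 ** A) x = 0" if "x \<noteq> 0" for x
      using A_nonzero[OF that]
      by (auto simp: N2(2) conic_pts_def pts_def PG_6 vanishes_at_span_1 qform_congruence)
    have "qform (transpose A ** N2 ** A) v = 0" if v: "v \<in> vecs q 1" "qform N v = 0" for v
    proof (cases "v = 0")
      case False
      then have "vec.span {A *v v} \<in> C" using v C_eq by blast
      then show ?thesis using * False assms(10,12) by blast
    qed simp
    moreover have "nondegenerate_on UNIV (transpose A ** N2 ** A)"
      using N2(1) bijA by (rule nondegenerate_on_congruence)
    ultimately show ?thesis
      using conic_determined_by_rational_points[OF N1 N_nd] assms(3) *[OF x] by simp
  qed
  have L_sub: "vec.subspace L" using assms(5) by (simp add: line_over_def subspace_over_def)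
  have L_iff: "A *v x \<in> L \<longleftrightarrow> x $ 3 = 0" for x
    using injA by (auto simp: L_eq inj_eq)
  have pts_L: "vec.span {A *v x} \<in> pts q k L \<longleftrightarrow> vec.span {A *v x} \<in> PG q k \<and> x $ 3 = 0" for x k
    by (auto simp: pts_def subspace_span_subset_iff[OF L_sub] L_iff)
  have PG6: "vec.span {A *v x} \<in> PG q 6" if "x \<noteq> 0" for x
    using A_nonzero[OF that] by (auto simp: PG_6)
  have coords: "\<exists>x. x \<noteq> 0 \<and> X = vec.span {A *v x} \<and> x $ 3 = 0 \<and> qform N x = 0" if "X \<in> {P, Q}" for X
  proof -
    have X: "X \<in> Cpp" "X \<in> pts q 6 L" using that assms(13) by auto
    have "X \<in> PG q 6" using X(2) by (simp add: pts_def)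
    from ptE[OF this] obtain x where x: "x \<noteq> 0" "X = vec.span {A *v x}" by (elim exE conjE)
    then show ?thesis using X Cpp_iff[OF x(1)] pts_L[of x 6] by (intro exI[of _ x]) simp
  qed
  obtain p where p: "p \<noteq> 0" "P = vec.span {A *v p}" "p $ 3 = 0" "qform N p = 0"
    using coords[of P] by auto
  obtain r where r: "r \<noteq> 0" "Q = vec.span {A *v r}" "r $ 3 = 0" "qform N r = 0"
    using coords[of Q] by auto
  have in_PQ: "vec.span {A *v x} \<in> {P, Q}" if "x \<noteq> 0" "x $ 3 = 0" "qform N x = 0" for x
  proof -
    have "vec.span {A *v x} \<in> Cpp \<inter> pts q 6 L"
      using that by (simp add: Cpp_iff pts_L PG6)
    then show ?thesis by (simp only: assms(13))
  qed
  have pr: "x \<in> vec.span {p} \<or> x \<in> vec.span {r}" if "x \<noteq> 0" "x $ 3 = 0" "qform N x = 0" for x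
    using in_PQ[OF that] A_span[OF that(1) p(1)] A_span[OF that(1) r(1)] p(2) r(2) by auto

  have cB: "cB (vec.span {A *v x}) = vec.span {A *v frob q x}" if "x \<noteq> 0" for x
    using subplane_conj_coordinates[OF assms(14) bijA _ that] B_eq by blast
  have cB_iter: "(cB ^^ n) (vec.span {A *v x}) = vec.span {A *v ((frob q ^^ n) x)}" if "x \<noteq> 0" for x n
    using that by (induction n) (simp_all add: cB)
  have scroll_cB: "scroll_plane q f cB (vec.span {A *v x}) = scroll x" if "x \<noteq> 0" for x
    unfolding scroll_plane_def cB_iter[OF that] f_pt scroll_eq_span ..
  have rational_PG: "vec.span {A *v x} \<in> PG q 3" if "x \<in> vecs q 1" "x \<noteq> 0" for x
  proof -
    have "(frob q ^^ 3) x = x" using that(1) by (simp add: in_vecs_1_iff numeral_3_eq_3)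
    then have "A *v x \<in> vecs q 3" using frob_iter_mats[OF A3, of x] by (simp add: in_vecs_iff)
    then show ?thesis using A_nonzero[OF that(2)] by (auto simp: PG_def)
  qed
  have cb: "cb (vec.span {A *v x}) = vec.span {A *v frob q x}" if "x \<noteq> 0" "x $ 3 = 0" for x
  proof (rule subline_conj_coordinates[OF assms(15) bijA L_eq _ that])
    fix y :: "'a ^ 3" assume "y \<in> vecs q 1" "y \<noteq> 0" "y $ 3 = 0"
    then show "vec.span {A *v y} \<in> B \<inter> pts q 3 L"
      using rational_PG pts_L B_eq by blast
  qed
  have cb_iter: "(cb ^^ n) (vec.span {A *v x}) = vec.span {A *v ((frob q ^^ n) x)}"
    if "x \<noteq> 0" "x $ 3 = 0" for x n
    using that by (induction n) (simp_all add: cb frob_iter_nth q_pos)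
  have scroll_cb: "scroll_plane q f cb (vec.span {A *v x}) = scroll x" if "x \<noteq> 0" "x $ 3 = 0" for x
    unfolding scroll_plane_def cb_iter[OF that] f_pt scroll_eq_span ..

  have variety: "vec.span {v} \<in> variety_pts q 6 F \<longleftrightarrow> (\<exists>x. x \<noteq> 0 \<and> qform N x = 0 \<and> v \<in> scroll x)"
    if "v \<noteq> 0" for v
  proof -
    have Cpp_eq: "Cpp = {vec.span {A *v x} | x. x \<noteq> 0 \<and> qform N x = 0}"
    proof safe
      fix X assume X: "X \<in> Cpp"
      then have "X \<in> PG q 6" by (simp add: N2(2) conic_pts_def pts_def)
      from ptE[OF this] obtain x where x: "x \<noteq> 0" "X = vec.span {A *v x}" by (elim exE conjE)
      then show "\<exists>x. X = vec.span {A *v x} \<and> x \<noteq> 0 \<and> qform N x = 0"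
        using X Cpp_iff[OF x(1)] by (intro exI[of _ x]) simp
    qed (use Cpp_iff in blast)
    have var: "variety_pts q 6 F = (\<Union>X\<in>Cpp. pts q 6 (scroll_plane q f cB X))"
      using assms(21) by (simp add: conic_variety_def)
    have on: "vec.span {v} \<in> pts q 6 (scroll_plane q f cB (vec.span {A *v x})) \<longleftrightarrow> v \<in> scroll x"
      if "x \<noteq> 0" for x
      using \<open>v \<noteq> 0\<close> by (auto simp: scroll_cB[OF that] pts_def PG_6
          subspace_span_subset_iff[OF subspace_scroll])
    show ?thesis
    proof
      assume "vec.span {v} \<in> variety_pts q 6 F"
      then obtain x where "x \<noteq> 0" "qform N x = 0"
        "vec.span {v} \<in> pts q 6 (scroll_plane q f cB (vec.span {A *v x}))"
        unfolding var Cpp_eq by auto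
      then show "\<exists>x. x \<noteq> 0 \<and> qform N x = 0 \<and> v \<in> scroll x"
        using on by (intro exI[of _ x]) simp
    next
      assume "\<exists>x. x \<noteq> 0 \<and> qform N x = 0 \<and> v \<in> scroll x"
      then obtain x where x: "x \<noteq> 0" "qform N x = 0" "v \<in> scroll x" by (elim exE conjE)
      then have "vec.span {A *v x} \<in> Cpp" by (simp add: Cpp_iff)
      moreover have "vec.span {v} \<in> pts q 6 (scroll_plane q f cB (vec.span {A *v x}))"
        using on[OF x(1)] x(3) by simp
      ultimately show "vec.span {v} \<in> variety_pts q 6 F" unfolding var by (rule UN_I)
    qed
  qed
  have E_sub: "vec.subspace (range D)"
    using plane_over_range_D by (simp add: plane_over_def subspace_over_def)
  \<comment> \<open>All pointsets over a smaller field are cut out by the same equations as over the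
    largest one, so a single equivalence for a representative v settles every k.\<close>
  have sections: "section_pts q k F S6 =
      conic_pts q k (range D) M \<union> pts q k (scroll p) \<union> pts q k (scroll r)" for k
  proof (rule Set.set_eqI)
    fix X
    show "X \<in> section_pts q k F S6 \<longleftrightarrow>
      X \<in> conic_pts q k (range D) M \<union> pts q k (scroll p) \<union> pts q k (scroll r)"
    proof (cases "X \<in> PG q k")
      case True
      then obtain v where v: "v \<noteq> 0" "X = vec.span {v}" by (auto simp: PG_def)
      have "X \<in> section_pts q k F S6 \<longleftrightarrow> X \<in> variety_pts q 6 F \<and> v \<in> S6"
        using True PG_subset_PG_6 S6_sub
        by (auto simp: section_pts_def variety_pts_def pts_def v(2) subspace_span_subset_iff)
      also have "\<dots> \<longleftrightarrow> v \<in> range D \<and> qform M v = 0 \<or> v \<in> scroll p \<or> v \<in> scroll r"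
        unfolding v(2) variety[OF v(1)]
        using section_decomposition[OF S6 \<tau> M p(1,3,4) r(1,3,4) pr v(1)] .
      also have "\<dots> \<longleftrightarrow> X \<in> conic_pts q k (range D) M \<union> pts q k (scroll p) \<union> pts q k (scroll r)"
        using True E_sub by (auto simp: conic_pts_def pts_def v(2) subspace_span_subset_iff
            subspace_scroll vanishes_at_span_1)
      finally show ?thesis .
    qed (auto simp: section_pts_def variety_pts_def conic_pts_def pts_def)
  qed

  have conic_infinity: "conic_pts q 6 (range D) M \<inter> pts q 6 infinity = {vec.span {D p}, vec.span {D r}}"
  proof (intro equalityI subsetI)
    fix X assume "X \<in> conic_pts q 6 (range D) M \<inter> pts q 6 infinity"
    then have X: "X \<in> conic_pts q 6 (range D) M" "X \<in> pts q 6 infinity" by auto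
    then obtain v where v: "v \<noteq> 0" "X = vec.span {v}" by (auto simp: pts_def PG_6)
    then obtain x where x: "v = D x" using X(1)
      by (auto simp: conic_pts_def pts_def subspace_span_subset_iff[OF E_sub])
    then have "x \<noteq> 0" "x $ 3 = 0" "qform N x = 0"
      using X v \<tau> by (auto simp: conic_pts_def pts_def vanishes_at_span_1 M
          subspace_span_subset_iff[OF subspace_infinity])
    then show "X \<in> {vec.span {D p}, vec.span {D r}}"
      using pr[of x] p(1) r(1) by (auto simp: v(2) x span_1_eq_iff D_in_span_iff)
  next
    fix X assume "X \<in> {vec.span {D p}, vec.span {D r}}"
    then obtain x where x: "X = vec.span {D x}" "x \<noteq> 0" "x $ 3 = 0" "qform N x = 0"
      using p r by blast
    moreover have "vec.span {D x} \<in> PG q 6"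
      unfolding PG_6 using x(2) by (intro exI[of _ "D x"]) simp
    ultimately show "X \<in> conic_pts q 6 (range D) M \<inter> pts q 6 infinity"
      by (simp add: conic_pts_def pts_def M vanishes_at_span_1
          subspace_span_subset_iff[OF subspace_infinity] subspace_span_subset_iff[OF E_sub])
  qed

  have rational_scroll: "bose q f (vec.span {A *v x}) = scroll x" if "x \<in> vecs q 1" for x
    using frob_span_rational_point[of x] that by (simp add: bose_def f_pt in_vecs_1_iff)

  \<comment> \<open>The spread planes met by the plane \<open>range D\<close> are exactly those of
    the q + 1 points of B on L: a rational point \<open>D y\<close> forces y to be proportional to a
    rational vector.\<close>
  have spread_count: "card {S \<in> spread q f L. pts q 1 (range D) \<inter> S \<noteq> {}} = q + 1"
  proof -
    let ?g = "\<lambda>X. pts q 1 (bose q f X)"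
    have BL: "\<exists>x. x \<in> vecs q 1 \<and> x \<noteq> 0 \<and> X = vec.span {A *v x} \<and> x $ 3 = 0" if "X \<in> B \<inter> pts q 3 L" for X
      using that B_eq pts_L by auto
    have DPG: "vec.span {D x} \<in> pts q 1 (range D) \<inter> ?g (vec.span {A *v x})"
      if x: "x \<in> vecs q 1" "x \<noteq> 0" for x
    proof -
      have "frob q (D x) \<in> vec.span {D x}"
        using x(1) by (auto simp: frob_D in_vecs_1_iff intro: vec.span_base)
      then have "vec.span {D x} \<in> PG q 1" using x by (simp add: PG_1_iff)
      then show ?thesis
        by (simp add: pts_def rational_scroll[OF x(1)] subspace_span_subset_iff[OF subspace_scroll]
            subspace_span_subset_iff[OF E_sub] D_in_scroll)
    qed
    have "{S \<in> spread q f L. pts q 1 (range D) \<inter> S \<noteq> {}} = ?g ` (B \<inter> pts q 3 L)"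
    proof (intro equalityI subsetI)
      fix S assume "S \<in> ?g ` (B \<inter> pts q 3 L)"
      then obtain X where X: "X \<in> B \<inter> pts q 3 L" "S = ?g X" by blast
      then obtain x where "x \<in> vecs q 1" "x \<noteq> 0" "X = vec.span {A *v x}" using BL by blast
      then show "S \<in> {S \<in> spread q f L. pts q 1 (range D) \<inter> S \<noteq> {}}"
        using DPG X by (auto simp: spread_def)
    next
      fix S assume "S \<in> {S \<in> spread q f L. pts q 1 (range D) \<inter> S \<noteq> {}}"
      then obtain X Y where X: "X \<in> pts q 3 L" "S = ?g X" and Y: "Y \<in> pts q 1 (range D)" "Y \<in> ?g X"
        by (auto simp: spread_def)
      obtain x where x: "x \<noteq> 0" "X = vec.span {A *v x}"
      proof -
        have "X \<in> PG q 3" using X(1) by (simp add: pts_def)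
        from ptE[OF this] show ?thesis using that by blast
      qed
      obtain v where v: "v \<noteq> 0" "Y = vec.span {v}" using Y by (auto simp: pts_def PG_def)
      have v_in: "v \<in> range D" "v \<in> bose q f X"
        using Y vec.span_base[of v "{v}"] by (auto simp: pts_def v(2))
      obtain y where y: "v = D y" using v_in by blast
      have y0: "y \<noteq> 0" using v(1) y by simp
      have "vec.span {D y} \<in> PG q 1" using Y by (simp add: pts_def v(2) y)
      then have "frob q (D y) \<in> vec.span {D y}" using y0 by (simp add: PG_1_iff)
      then have "frob q y \<in> vec.span {y}" by (simp add: frob_D D_in_span_iff)
      then obtain c where c: "c \<noteq> 0" "c *s y \<in> vecs q 1" using frob_fixed_point y0 by blast
      \<comment> \<open>The first block suffices: in the plane of X it is a multiple of x, while in
        \<open>D y\<close> it is \<delta> y.\<close>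
      have "\<exists>a. \<delta> *s y = a *s x"
        using v_in(2) by (auto simp: x(2) y bose_def f_pt frob_span_point D_def)
      then obtain a where a: "\<delta> *s y = a *s x" by blast
      have "y = (a / \<delta>) *s x"
      proof -
        have "inverse \<delta> *s (\<delta> *s y) = inverse \<delta> *s (a *s x)" using a by simp
        then show ?thesis by (simp add: divide_inverse mult.commute)
      qed
      then have "c *s y \<in> vec.span {x}" by (auto simp: span_1)
      then have "X = vec.span {A *v (c *s y)}" using A_span[of "c *s y" x] c(1) x y0 by simp
      moreover have "c *s y \<noteq> 0" using c(1) y0 by simp
      ultimately have "X \<in> B" unfolding B_eq using c(2) by blast
      then show "S \<in> ?g ` (B \<inter> pts q 3 L)" using X by blast
    qed
    moreover have "inj_on ?g (B \<inter> pts q 3 L)"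
    proof (rule inj_onI)
      fix X Y assume X: "X \<in> B \<inter> pts q 3 L" and Y: "Y \<in> B \<inter> pts q 3 L" and eq: "?g X = ?g Y"
      obtain x where x: "x \<in> vecs q 1" "x \<noteq> 0" "X = vec.span {A *v x}" using BL X by blast
      obtain y where y: "y \<in> vecs q 1" "y \<noteq> 0" "Y = vec.span {A *v y}" using BL Y by blast
      have "vec.span {D x} \<in> ?g Y" using DPG[OF x(1,2)] x(3) eq by blast
      then have "D x \<in> scroll y"
        by (simp add: pts_def y(3) rational_scroll[OF y(1)] subspace_span_subset_iff[OF subspace_scroll])
      then obtain a where a: "\<delta> *s x = a *s y" by (auto simp: scroll_def D_def)
      have "x = (a / \<delta>) *s y"
      proof -
        have "inverse \<delta> *s (\<delta> *s x) = inverse \<delta> *s (a *s y)" using a by simp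
        then show ?thesis by (simp add: divide_inverse mult.commute)
      qed
      then have "x \<in> vec.span {y}" by (auto simp: span_1)
      then show "X = Y" using A_span[OF x(2) y(2)] x(3) y(3) by simp
    qed
    ultimately show ?thesis using assms(7) by (simp add: card_image)
  qed

  have case1: "scroll p = bose q f P \<and> scroll r = bose q f Q \<and>
      pts q 1 (bose q f P) \<in> spread q f L \<and> pts q 1 (bose q f Q) \<in> spread q f L \<and>
      pts q 1 (bose q f P) \<union> pts q 1 (bose q f Q) \<subseteq> section_pts q 1 F S6 \<and>
      (\<exists>R S. R \<in> pts q 1 (bose q f P) \<and> S \<in> pts q 1 (bose q f Q) \<and> (R = S \<longleftrightarrow> P = Q) \<and>
         conic_pts q 1 (range D) M \<inter> pts q 1 infinity = {R, S} \<and>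
         conic_pts q 6 (range D) M \<inter> pts q 6 infinity = {R, S})"
    if CL: "C \<inter> pts q 3 L = {P, Q}"
  proof -
    \<comment> \<open>The vectors p and r were chosen over the largest field. Membership in C gives
      a rational vector spanning the same point, and both the scroll-plane and the point of the
      conic depend only on the span.\<close>
    have rational: "bose q f (vec.span {A *v x}) = scroll x \<and> vec.span {D x} \<in> PG q 1"
      if x: "x \<noteq> 0" "vec.span {A *v x} \<in> C" for x
    proof -
      obtain y where y: "y \<in> vecs q 1" "y \<noteq> 0" "vec.span {A *v x} = vec.span {A *v y}"
        using x(2) C_eq by blast
      then have xy: "x \<in> vec.span {y}"
        using A_span[OF x(1) y(2)] by simp
      then have "scroll x = scroll y"
        using span_1_eq_iff[OF x(1) y(2)] by (intro scroll_cong) simp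
      moreover have "vec.span {D x} = vec.span {D y}"
        using x(1) y(2) xy by (simp add: span_1_eq_iff D_in_span_iff)
      moreover have "vec.span {D y} \<in> PG q 1"
        using y by (simp add: PG_1_iff frob_D in_vecs_1_iff vec.span_base)
      ultimately show ?thesis using rational_scroll[OF y(1)] y(3) by simp
    qed
    have PQC: "P \<in> C" "Q \<in> C" "P \<in> pts q 3 L" "Q \<in> pts q 3 L" using CL by auto
    have bP: "bose q f P = scroll p" "vec.span {D p} \<in> PG q 1" using rational[of p] p PQC by auto
    have bQ: "bose q f Q = scroll r" "vec.span {D r} \<in> PG q 1" using rational[of r] r PQC by auto
    have "conic_pts q 1 (range D) M \<inter> pts q 1 infinity =
        PG q 1 \<inter> (conic_pts q 6 (range D) M \<inter> pts q 6 infinity)"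
      using PG_subset_PG_6 by (auto simp: conic_pts_def pts_def)
    then have "conic_pts q 1 (range D) M \<inter> pts q 1 infinity = {vec.span {D p}, vec.span {D r}}"
      using bP(2) bQ(2) unfolding conic_infinity by blast
    moreover have "vec.span {D p} \<in> pts q 1 (scroll p)" "vec.span {D r} \<in> pts q 1 (scroll r)"
      using bP(2) bQ(2) by (simp_all add: pts_def subspace_span_subset_iff[OF subspace_scroll] D_in_scroll)
    moreover have "vec.span {D p} = vec.span {D r} \<longleftrightarrow> P = Q"
      using p r A_span[OF p(1) r(1)] by (simp add: span_1_eq_iff D_in_span_iff)
    moreover have "pts q 1 (bose q f P) \<in> spread q f L" "pts q 1 (bose q f Q) \<in> spread q f L"
      unfolding spread_def using PQC(3,4) by (blast intro: imageI)+
    moreover have "pts q 1 (scroll p) \<union> pts q 1 (scroll r) \<subseteq> section_pts q 1 F S6"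
      unfolding sections by blast
    ultimately show ?thesis
      using conic_infinity unfolding bP(1) bQ(1)
      by (intro conjI refl exI[of _ "vec.span {D p}"] exI[of _ "vec.span {D r}"])
  qed

  have case2: "Cp \<inter> pts q 3 L = {} \<and>
      {P, Q} \<subseteq> pts q 6 L - pts q 3 L \<and> P \<noteq> Q \<and>
      scroll p = scroll_plane q f cb P \<and> scroll r = scroll_plane q f cb Q \<and>
      pts q 6 (scroll_plane q f cb P) \<union> pts q 6 (scroll_plane q f cb Q) \<subseteq> section_pts q 6 F S6 \<and>
      (\<exists>K. conic_pts q 6 (range D) M \<inter> pts q 6 infinity = {K, frob q ` K} \<and> K \<noteq> frob q ` K \<and>
         {K, frob q ` K} \<subseteq> pts q 6 infinity - pts q 3 infinity \<and>
         (\<forall>T. T_line q f L T \<longrightarrow> \<not> K \<subseteq> T))"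
    if CL: "C \<inter> pts q 3 L = {}"
  proof -
    have frob_on: "frob q x \<noteq> 0 \<and> frob q x $ 3 = 0 \<and> qform N (frob q x) = 0"
      if "x \<noteq> 0" "x $ 3 = 0" "qform N x = 0" for x
      using that by (simp add: qform_frob[OF N1])
    \<comment> \<open>By \<open>frob_fixed_point\<close>, a zero at infinity whose point is fixed by
      the Frobenius map would have a rational multiple, hence give a point of C on L.\<close>
    have moved: "vec.span {A *v frob q x} \<noteq> vec.span {A *v x}"
      if x: "x \<noteq> 0" "x $ 3 = 0" "qform N x = 0" for x
    proof
      assume "vec.span {A *v frob q x} = vec.span {A *v x}"
      then have "frob q x \<in> vec.span {x}" using A_span[of "frob q x" x] x(1) by simp
      then obtain c where c: "c \<noteq> 0" "c *s x \<in> vecs q 1" using frob_fixed_point x(1) by blast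
      then have cx: "c *s x \<noteq> 0" using x(1) by simp
      then have "vec.span {A *v (c *s x)} \<in> C"
        unfolding C_eq using c x(3) by (auto simp: qform_scale)
      moreover have "vec.span {A *v (c *s x)} \<in> pts q 3 L"
        unfolding pts_L using rational_PG c(2) cx x(2) by simp
      ultimately show False using CL by blast
    qed
    text \<open>The Frobenius map swaps the two points, so its third power has no fixed point here.\<close>
    have moved3: "(frob q ^^ 3) x \<notin> vec.span {x}" if x: "x \<noteq> 0" "x $ 3 = 0" "qform N x = 0" for x
    proof -
      define y where "y = frob q x"
      define z where "z = frob q y"
      define w where "w = frob q z"
      have y: "y \<noteq> 0" "y $ 3 = 0" "qform N y = 0" using frob_on[OF x] by (auto simp: y_def)
      have z: "z \<noteq> 0" "z $ 3 = 0" "qform N z = 0" using frob_on[OF y] by (auto simp: z_def)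
      have w: "w \<noteq> 0" "w $ 3 = 0" "qform N w = 0" using frob_on[OF z] by (auto simp: w_def)
      have "vec.span {A *v w} \<noteq> vec.span {A *v x}"
        using in_PQ[OF x] in_PQ[OF y] in_PQ[OF z] in_PQ[OF w]
          moved[OF x, folded y_def] moved[OF y, folded z_def] moved[OF z, folded w_def] by auto
      then show ?thesis using A_span[OF w(1) x(1)] by (simp add: funpow_simps w_def z_def y_def)
    qed
    have not_PG: "vec.span {A *v x} \<notin> PG q 3" if x: "x \<noteq> 0" "x $ 3 = 0" "qform N x = 0" for x
    proof
      assume "vec.span {A *v x} \<in> PG q 3"
      then have "(frob q ^^ 3) (A *v x) \<in> vec.span {A *v x}" by (rule PG_memD)
      then have "A *v ((frob q ^^ 3) x) \<in> vec.span {A *v x}" by (simp add: frob_iter_mats[OF A3])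
      then have "(frob q ^^ 3) x \<in> vec.span {x}"
        using injA by (auto simp: span_1 inj_eq simp flip: vec.scale)
      then show False using moved3[OF x] by blast
    qed
    have PQ: "{P, Q} \<subseteq> pts q 6 L - pts q 3 L"
      using assms(13) not_PG[OF p(1,3,4)] not_PG[OF r(1,3,4)] p(2) r(2) by (auto simp: pts_def)
    have "pts q 3 L \<subseteq> pts q 6 L"
      using PG_subset_PG_6 by (auto simp: pts_def)
    then have "Cp \<inter> pts q 3 L \<subseteq> {P, Q}"
      unfolding assms(13)[symmetric] using assms(12) by (rule Int_mono[rotated])
    moreover have "P \<notin> pts q 3 L" "Q \<notin> pts q 3 L" using PQ by auto
    ultimately have Cp: "Cp \<inter> pts q 3 L = {}" by auto
    note fp = frob_on[OF p(1,3,4)]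
    have frob_p: "vec.span {A *v frob q p} = Q"
      using in_PQ[of "frob q p"] fp moved[OF p(1,3,4)] p(2) by auto
    have neq: "P \<noteq> Q" using moved[OF p(1,3,4)] frob_p p(2) by auto
    have "r \<in> vec.span {frob q p}" using frob_p A_span[of r "frob q p"] r(1,2) fp by simp
    \<comment> \<open>Q is spanned by the image under A of the conjugate of p. As D commutes with
      the Frobenius map, the second point at infinity is K^q for K spanned by
      \<open>D p\<close>.\<close>
    then have Dr: "vec.span {D r} = frob q ` vec.span {D p}"
      using r(1) fp by (simp add: frob_image_span_1 frob_D span_1_eq_iff D_in_span_iff)
    have Dpr: "vec.span {D p} \<noteq> vec.span {D r}"
      using neq A_span[OF p(1) r(1)] p r by (simp add: span_1_eq_iff D_in_span_iff)
    have D_not_PG: "vec.span {D x} \<notin> PG q 3" if x: "x \<noteq> 0" "x $ 3 = 0" "qform N x = 0" for x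
    proof
      assume "vec.span {D x} \<in> PG q 3"
      then have "(frob q ^^ 3) (D x) \<in> vec.span {D x}" by (rule PG_memD)
      then have "(frob q ^^ 3) x \<in> vec.span {x}" by (simp add: funpow_simps frob_D D_in_span_iff)
      then show False using moved3[OF x] by blast
    qed
    have no_T: "\<not> vec.span {D p} \<subseteq> T" if T: "T_line q f L T" for T
    proof -
      have Ts: "vec.subspace T" "vec.dim T = 2"
        using T by (auto simp: T_line_def line_over_def subspace_over_def)
      obtain i j where ij: "i < 3" "j < 3" "i \<noteq> j"
        and i: "pts q 6 (T \<inter> ((`) (frob q) ^^ i) (f ` L)) \<noteq> {}"
        and j: "pts q 6 (T \<inter> ((`) (frob q) ^^ j) (f ` L)) \<noteq> {}"
        using T unfolding T_line_def by blast
      have ex: "\<exists>u. u \<noteq> 0 \<and> u \<in> U" if "pts q 6 U \<noteq> {}" for U :: "('a ^ 9) set"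
        using that vec.span_base by (auto simp: pts_def PG_6)
      obtain u where u: "u \<in> T" "u \<noteq> 0" "u \<in> ((`) (frob q) ^^ i) (f0 ` {x. x $ 3 = 0})"
        using ex[OF i] unfolding f_L by blast
      obtain w where w: "w \<in> T" "w \<noteq> 0" "w \<in> ((`) (frob q) ^^ j) (f0 ` {x. x $ 3 = 0})"
        using ex[OF j] unfolding f_L by blast
      show ?thesis
        using D_not_on_T_line[OF p(1) Ts ij u w] Ts(1) by (simp add: subspace_span_subset_iff)
    qed
    have scrolls: "scroll p = scroll_plane q f cb P" "scroll r = scroll_plane q f cb Q"
      using scroll_cb p r by simp_all
    have "{vec.span {D p}, vec.span {D r}} \<subseteq> pts q 6 infinity - pts q 3 infinity"
      using conic_infinity D_not_PG[OF p(1,3,4)] D_not_PG[OF r(1,3,4)] by (auto simp: pts_def)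
    moreover have "pts q 6 (scroll p) \<union> pts q 6 (scroll r) \<subseteq> section_pts q 6 F S6"
      unfolding sections by blast
    moreover have "\<forall>T. T_line q f L T \<longrightarrow> \<not> vec.span {D p} \<subseteq> T"
      using no_T by simp
    ultimately show ?thesis
      using Cp PQ neq conic_infinity Dpr unfolding Dr scrolls[symmetric]
      by (intro conjI refl exI[of _ "vec.span {D p}"])
  qed

  have nd: "nondegenerate_on (range D) M"
    unfolding nondegenerate_on_def
  proof (intro ballI impI)
    fix v assume v: "v \<in> range D" "v \<noteq> 0" "qform M v = 0"
    then obtain x where x: "v = D x" by blast
    then have "x \<noteq> 0" "qform N x = 0" using v M \<tau> by auto
    then obtain y where "polar_form N x y \<noteq> 0" using N_nd by (auto simp: nondegenerate_on_def)
    then show "\<exists>w\<in>range D. polar_form M v w \<noteq> 0" using M_polar \<tau> x by auto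
  qed
  have "D x \<in> S6" for x
    unfolding D_def S6 by (auto intro!: exI[of _ "x $ 3"])
  moreover have "D (axis 3 1) \<notin> infinity" by simp
  ultimately have E: "range D \<subseteq> S6" "\<not> range D \<subseteq> infinity" by blast+
  show ?thesis
    unfolding Sinf
    by (rule exI[of _ "range D"], rule exI[of _ M], rule exI[of _ "scroll p"], rule exI[of _ "scroll r"],
        intro conjI)
      (rule plane_over_range_D E spread_count M1 nd plane_over_scroll[OF p(1)] plane_over_scroll[OF r(1)]
        scroll_subset_infinity[OF p(3)] scroll_subset_infinity[OF r(3)] sections[THEN ballI]
      | rule impI, erule case1 | rule impI, erule case2)+
qed

end
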